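(* Fix an integer $r\ge 4$. For every $\delta>0$, there exist $\epsilon>0$ and $n_0$ such that, for all $n\ge n_0$, every $n$-vertex $\mathcal C_4^r$-free $r$-graph with at least $(1-\epsilon)\binom{n-1}{r-1}$ edges contains a vertex $v$ that belongs to at least $(1-\delta)\binom{n-1}{r-1}$ edges.
   Context: An $r$-graph is an $r$-uniform hypergraph. A generalized $4$-cycle ($r$-uniform) consists of four distinct $r$-sets $A,B,C,D$ such that $A\cup B=C\cup D$ and $A\cap B=C\cap D=\emptyset$; $\mathcal C_4^r$ denotes the family of all of them. An $r$-graph is $\mathcal C_4^r$-free if no four of its edges form a generalized $4$-cycle. *)

theory Defs
  imports Complex_Main "HOL-Library.Ramsey"
begin

definition r_graph :: "nat \<Rightarrow> 'a set \<Rightarrow> 'a set set \<Rightarrow> bool" where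
  "r_graph r V E \<longleftrightarrow> finite V \<and> E \<subseteq> nsets V r"

text \<open>A generalized 4-cycle is represented by its edge set, the 4-element set of \<open>r\<close>-sets
  \<open>{A, B, C, D}\<close>; its two disjoint pairs are \<open>A, B\<close> and \<open>C, D\<close>.\<close>

definition gen_4_cycles :: "nat \<Rightarrow> 'a set set set" where
  "gen_4_cycles r =
     {{A, B, C, D} | A B C D.
        {A, B, C, D} \<subseteq> nsets UNIV r \<and> distinct [A, B, C, D] \<and>
        A \<union> B = C \<union> D \<and> A \<inter> B = {} \<and> C \<inter> D = {}}"

definition gen_4_cycle_free :: "nat \<Rightarrow> 'a set set \<Rightarrow> bool" where
  "gen_4_cycle_free r E \<longleftrightarrow> \<not> (\<exists>F \<in> gen_4_cycles r. F \<subseteq> E)"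

end

theory Submission
  imports Defs "HOL-Analysis.Convex"
begin

text \<open>Let \<open>n\<close> be the number of vertices, \<open>B = n^(r-1)\<close> and \<open>L = B / (r-1)!\<close>, so that the binomial
  coefficient of \<open>n - 1\<close> over \<open>r - 1\<close> is \<open>L - o(B)\<close>.  Only one consequence of cycle-freeness is ever used
  (\<open>common_link_intersecting\<close>): for disjoint nonempty \<open>P1\<close>, \<open>P2\<close> the sets \<open>Q\<close> for which both
  \<open>P1 \<union> Q\<close> and \<open>P2 \<union> Q\<close> are edges intersect pairwise, since disjoint \<open>Q1\<close>, \<open>Q2\<close> would give the cycle
  \<open>P1 \<union> Q1\<close>, \<open>P2 \<union> Q2\<close>, \<open>P1 \<union> Q2\<close>, \<open>P2 \<union> Q1\<close>.  It is applied to sets \<open>P1\<close>, \<open>P2\<close> of three sizes.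

  Size \<open>r - 1\<close>: disjoint sets have at most one common extension, so few pairwise disjoint sets can have at
  least \<open>c n\<close> extensions each, and a bounded set of vertices meets all of these rich sets
  (\<open>rich_sets_cover\<close>).  Repeating this with rapidly decreasing \<open>c\<close>, a pigeonhole argument
  (\<open>codegree_gap\<close>) yields a bounded set \<open>W\<close> such that, up to \<open>o(B)\<close> edges, each edge either meets \<open>W\<close> or
  belongs to a subgraph \<open>E'\<close> avoiding \<open>W\<close> in which every \<open>(r-1)\<close>-set has at most \<open>c n\<close> extensions, where
  \<open>c\<close> is tiny even compared with \<open>1 / |W|\<close>.  At most \<open>b + o(B)\<close> edges meet \<open>W\<close>, where \<open>b\<close>
  counts the \<open>(r-1)\<close>-sets outside \<open>W\<close> that some vertex of \<open>W\<close> completes to an edge.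

  Size \<open>1\<close>: after deletion of \<open>o(B)\<close> edges of \<open>E'\<close>, all common neighbours \<open>S\<close> of two vertices \<open>w\<close>, \<open>w'\<close>
  share a vertex \<open>ctr w w'\<close> (\<open>centered_subgraph\<close>).

  Size \<open>r - 2\<close>: if two pairs \<open>Q\<close>, \<open>Q'\<close> both complete the disjoint sets \<open>P1\<close> and \<open>P2\<close> to edges of \<open>E'\<close>, then
  \<open>Q = {z, w}\<close> and \<open>Q' = {z, w'}\<close> with \<open>z = ctr w w'\<close>.  There are at most \<open>n\<^sup>2\<close> such \<open>(Q, Q')\<close> and about
  \<open>n\<^sup>2 / 2\<close> pairs \<open>Q\<close>, so that on average a pair \<open>Q\<close> lies in common links of size at most \<open>3\<close>.  A weighted
  version of the Kovari-Sos-Turan count (\<open>weighted_link_count\<close>) then bounds \<open>|E'|\<close>.  The weights exploit that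
  an \<open>(r-2)\<close>-set lying in edges of \<open>E'\<close> typically lies in almost none of the \<open>b\<close> sets above
  (\<open>sum_star_completions_le\<close>), and the outcome is \<open>|E'| \<le> 5/8 (L - b) + o(B)\<close> (\<open>thin_part_le\<close>); the
  constant comes from \<open>sqrt 6 / r < 5/8\<close>.

  Hence \<open>|E| \<le> b + 5/8 (L - b) + o(B)\<close>, and if \<open>|E| \<ge> L - o(B)\<close> then \<open>L - b = o(B)\<close>: almost every
  \<open>(r-1)\<close>-set is completed by a vertex of \<open>W\<close>.  Using sets of size \<open>r - 1\<close> once more, the completing vertex
  must be the same for almost all of them (\<open>dominant_star\<close>), and this vertex has degree \<open>L - o(B)\<close>.\<close>

section \<open>Counting in finite set families\<close>

lemma card_nsets_le_power:
  assumes "finite A"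
  shows "card (nsets A k) \<le> card A ^ k"
proof -
  have "(card A choose k) * 1 \<le> (card A choose k) * fact k"
    by (intro mult_left_mono) (auto simp: Suc_le_eq)
  also have "\<dots> \<le> card A ^ k"
    by (rule binomial_fact_pow)
  finally show ?thesis
    using assms by simp
qed

lemma card_nsets_meeting:
  assumes "finite A" "finite Y" "k \<ge> 1"
  shows "card {S \<in> nsets A k. S \<inter> Y \<noteq> {}} \<le> card Y * card A ^ (k - 1)"
proof -
  have "{S \<in> nsets A k. S \<inter> Y \<noteq> {}} \<subseteq> (\<lambda>(y, P). insert y P) ` (Y \<times> (nsets A (k - 1)))"
  proof
    fix S assume "S \<in> {S \<in> nsets A k. S \<inter> Y \<noteq> {}}"
    then obtain y where y: "y \<in> S" "y \<in> Y" and S: "S \<subseteq> A" "finite S" "card S = k"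
      by (auto simp: nsets_def)
    then have "S = insert y (S - {y})" "S - {y} \<in> nsets A (k - 1)"
      by (auto simp: nsets_def)
    with y show "S \<in> (\<lambda>(y, P). insert y P) ` (Y \<times> (nsets A (k - 1)))"
      by (intro image_eqI[of _ _ "(y, S - {y})"]) auto
  qed
  then have "card {S \<in> nsets A k. S \<inter> Y \<noteq> {}} \<le> card ((\<lambda>(y, P). insert y P) ` (Y \<times> (nsets A (k - 1))))"
    using assms by (intro card_mono) (auto intro: finite_imp_finite_nsets)
  also have "\<dots> \<le> card (Y \<times> (nsets A (k - 1)))"
    using assms by (intro card_image_le) (auto intro: finite_imp_finite_nsets)
  also have "\<dots> \<le> card Y * card A ^ (k - 1)"
    using card_nsets_le_power[OF assms(1)] by (auto simp: card_cartesian_product)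
  finally show ?thesis .
qed

lemma sum_card_supersets:
  assumes "finite X" "\<A> \<subseteq> nsets X m"
  shows "(\<Sum>Q\<in>nsets X k. card {A \<in> \<A>. Q \<subseteq> A}) = card \<A> * (m choose k)"
proof -
  have fin: "finite \<A>" "finite (nsets X k)"
    using assms finite_imp_finite_nsets finite_subset by blast+
  have "(\<Sum>Q\<in>nsets X k. card {A \<in> \<A>. Q \<subseteq> A}) = (\<Sum>Q\<in>nsets X k. \<Sum>A | A \<in> \<A> \<and> Q \<subseteq> A. 1)"
    by simp
  also have "\<dots> = (\<Sum>A\<in>\<A>. \<Sum>Q | Q \<in> nsets X k \<and> Q \<subseteq> A. 1)"
    by (rule sum.swap_restrict[OF fin(2,1)])
  also have "\<dots> = (\<Sum>A\<in>\<A>. m choose k)"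
  proof (rule sum.cong[OF refl])
    fix A assume "A \<in> \<A>"
    then have A: "A \<subseteq> X" "finite A" "card A = m"
      using assms(2) by (auto simp: nsets_def)
    then have "{Q. Q \<in> nsets X k \<and> Q \<subseteq> A} = nsets A k"
      by (auto simp: nsets_def)
    then show "(\<Sum>Q | Q \<in> nsets X k \<and> Q \<subseteq> A. 1) = (m choose k)"
      using A by simp
  qed
  finally show ?thesis by simp
qed

text \<open>This is the Cauchy-Schwarz inequality for the number of indices \<open>i\<close> with \<open>x \<in> N i\<close>, summed over \<open>x \<in> X\<close>.
  It serves to show that sets with small pairwise intersections are small on average.\<close>

lemma sum_card_squared_le:
  assumes "finite I" "finite X" and sub: "\<And>i. i \<in> I \<Longrightarrow> N i \<subseteq> X"
  shows "(\<Sum>i\<in>I. real (card (N i)))\<^sup>2 \<le> real (card X) * (\<Sum>i\<in>I. \<Sum>j\<in>I. real (card (N i \<inter> N j)))"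
proof -
  have cardX: "real (card A) = (\<Sum>x\<in>X. of_bool (x \<in> A))" if "A \<subseteq> X" for A
  proof -
    have "(\<Sum>x\<in>X. of_bool (x \<in> A)) = (real (card (X \<inter> A)) :: real)"
      using assms(2) by (simp add: of_bool_def sum.If_cases)
    moreover have "X \<inter> A = A"
      using that by auto
    ultimately show ?thesis by simp
  qed
  have "(\<Sum>i\<in>I. real (card (N i))) = (\<Sum>i\<in>I. \<Sum>x\<in>X. of_bool (x \<in> N i))"
    using cardX sub by simp
  also have "\<dots> = (\<Sum>x\<in>X. \<Sum>i\<in>I. of_bool (x \<in> N i))"
    by (rule sum.swap)
  finally have "(\<Sum>i\<in>I. real (card (N i)))\<^sup>2 = (\<Sum>x\<in>X. \<Sum>i\<in>I. of_bool (x \<in> N i))\<^sup>2"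
    by simp
  also have "\<dots> \<le> (\<Sum>x\<in>X. (\<Sum>i\<in>I. of_bool (x \<in> N i))\<^sup>2) * real (card X)"
    using sum_squared_le_sum_of_squares[of "\<lambda>x. \<Sum>i\<in>I. of_bool (x \<in> N i)" X] .
  also have "(\<Sum>x\<in>X. (\<Sum>i\<in>I. of_bool (x \<in> N i))\<^sup>2) = (\<Sum>x\<in>X. \<Sum>i\<in>I. \<Sum>j\<in>I. of_bool (x \<in> N i \<inter> N j) :: real)"
    by (simp add: power2_eq_square sum_product of_bool_conj)
  also have "\<dots> = (\<Sum>i\<in>I. \<Sum>x\<in>X. \<Sum>j\<in>I. of_bool (x \<in> N i \<inter> N j))"
    by (rule sum.swap)
  also have "\<dots> = (\<Sum>i\<in>I. \<Sum>j\<in>I. \<Sum>x\<in>X. of_bool (x \<in> N i \<inter> N j))"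
    by (intro sum.cong refl sum.swap)
  also have "\<dots> = (\<Sum>i\<in>I. \<Sum>j\<in>I. real (card (N i \<inter> N j)))"
    using cardX sub by (intro sum.cong refl) (metis inf.coboundedI1)
  finally show ?thesis
    by (simp add: mult.commute)
qed

text \<open>Every factor of the falling factorial of \<open>n - 1\<close> loses at most \<open>k + 1\<close> against \<open>n\<close>, whence a relative
  loss of order \<open>k\<^sup>2 / n\<close>.  Multiplying by \<open>n\<close> makes the estimate hold for all \<open>n\<close>: where the binomial
  coefficient vanishes, the left-hand side is not positive.\<close>

lemma binomial_fact_lower_bound:
  "real n ^ Suc k - real (Suc k) ^ 2 * real n ^ k \<le> real ((n - 1) choose k) * fact k * real n"
proof (induction k)
  case 0
  then show ?case by simp
next
  case (Suc k)
  show ?case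
  proof (cases "k < n")
    case True
    have "real (Suc k * ((n - 1) choose Suc k)) = real ((n - 1 - k) * ((n - 1) choose k))"
      by (simp only: binomial_absorption binomial_absorb_comp)
    then have "real (Suc k) * real ((n - 1) choose Suc k) = (real n - 1 - real k) * real ((n - 1) choose k)"
      using True by (simp only: of_nat_mult) (simp add: of_nat_diff)
    then have "(real (Suc k) * real ((n - 1) choose Suc k)) * (fact k * real n)
        = ((real n - 1 - real k) * real ((n - 1) choose k)) * (fact k * real n)"
      by (rule arg_cong)
    then have rec: "real ((n - 1) choose Suc k) * fact (Suc k) * real n
        = (real n - 1 - real k) * (real ((n - 1) choose k) * fact k * real n)"
      unfolding fact_Suc by (simp only: mult_ac of_nat_Suc)
    have "(real n - 1 - real k) * (real n ^ Suc k - real (Suc k) ^ 2 * real n ^ k)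
        \<le> (real n - 1 - real k) * (real ((n - 1) choose k) * fact k * real n)"
      using True by (intro mult_left_mono Suc.IH) auto
    moreover have "(real n - 1 - real k) * (real n ^ Suc k - real (Suc k) ^ 2 * real n ^ k)
        = real n ^ Suc (Suc k) - (real (Suc k) ^ 2 + real (Suc k)) * real n ^ Suc k + real (Suc k) ^ 3 * real n ^ k"
      by (simp add: algebra_simps power2_eq_square power3_eq_cube)
    moreover have "(real (Suc k) ^ 2 + real (Suc k)) * real n ^ Suc k \<le> real (Suc (Suc k)) ^ 2 * real n ^ Suc k"
      by (intro mult_right_mono) (auto simp: power2_eq_square algebra_simps)
    moreover have "real (Suc k) ^ 3 * real n ^ k \<ge> 0"
      by simp
    ultimately show ?thesis
      unfolding rec by linarith
  next
    case False
    have "real n \<le> real k" "0 \<le> real k * real k"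
      using False by auto
    moreover have "real (Suc (Suc k)) ^ 2 = real k * real k + 4 * real k + 4"
      by (simp add: power2_eq_square algebra_simps)
    ultimately have "real n \<le> real (Suc (Suc k)) ^ 2"
      by linarith
    then have "real n * real n ^ Suc k \<le> real (Suc (Suc k)) ^ 2 * real n ^ Suc k"
      by (intro mult_right_mono) auto
    moreover have "0 \<le> real ((n - 1) choose Suc k) * fact (Suc k) * real n"
      by simp
    ultimately show ?thesis
      unfolding power_Suc[of "real n" "Suc k"] by linarith
  qed
qed

section \<open>Links and the intersection property\<close>

definition link :: "'a set set \<Rightarrow> 'a set \<Rightarrow> 'a set set" where
  "link E P = {Q. P \<inter> Q = {} \<and> P \<union> Q \<in> E}"

lemma link_commute: "Q \<in> link E P \<longleftrightarrow> P \<in> link E Q"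
  by (auto simp: link_def Int_commute Un_commute)

lemma link_mono: "E' \<subseteq> E \<Longrightarrow> link E' P \<subseteq> link E P"
  by (auto simp: link_def)

locale c4_free_graph =
  fixes r :: nat and V :: "'a set" and E :: "'a set set"
  assumes r4: "r \<ge> 4"
    and finV: "finite V"
    and E_sub: "E \<subseteq> nsets V r"
    and free: "gen_4_cycle_free r E"

context c4_free_graph
begin

lemma subgraph: "E' \<subseteq> E \<Longrightarrow> c4_free_graph r V E'"
  using r4 finV E_sub free unfolding c4_free_graph_def gen_4_cycle_free_def by blast

lemma finE: "finite E"
  using E_sub finV finite_imp_finite_nsets finite_subset by blast

lemma finite_nsets_V: "finite (nsets V k)"
  by (rule finite_imp_finite_nsets[OF finV])

lemma edgeD: "A \<in> E \<Longrightarrow> A \<subseteq> V \<and> finite A \<and> card A = r"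
  using E_sub by (auto simp: nsets_def)

lemma finite_link: "finite (link E P)"
proof -
  have "link E P \<subseteq> Pow V"
    using edgeD by (auto simp: link_def)
  then show ?thesis
    using finV finite_subset by blast
qed

lemma linkD:
  assumes "Q \<in> link E P"
  shows "P \<inter> Q = {}" "P \<union> Q \<in> E" "finite P" "finite Q" "P \<subseteq> V" "Q \<subseteq> V" "card P + card Q = r"
proof -
  show 1: "P \<inter> Q = {}" "P \<union> Q \<in> E"
    using assms by (auto simp: link_def)
  show 2: "finite P" "finite Q" "P \<subseteq> V" "Q \<subseteq> V"
    using edgeD[OF 1(2)] by auto
  show "card P + card Q = r"
    using edgeD[OF 1(2)] card_Un_disjoint[OF 2(1,2) 1(1)] by simp
qed

lemma link_subset_nsets: "card P + k = r \<Longrightarrow> link E P \<subseteq> nsets V k"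
  using linkD by (fastforce simp: nsets_def)

lemma card_link_eq: "card (link E Q) = card {A \<in> E. Q \<subseteq> A}"
proof -
  have "bij_betw (\<lambda>P. Q \<union> P) (link E Q) {A \<in> E. Q \<subseteq> A}"
    by (rule bij_betwI[of _ _ _ "\<lambda>A. A - Q"]) (auto simp: link_def Un_absorb1)
  then show ?thesis
    by (rule bij_betw_same_card)
qed

lemma sum_card_link: "(\<Sum>Q\<in>nsets V k. card (link E Q)) = card E * (r choose k)"
  using sum_card_supersets[OF finV E_sub] by (simp add: card_link_eq)

text \<open>The only place where cycle-freeness enters: disjoint \<open>Q1\<close>, \<open>Q2\<close> would make \<open>P1 \<union> Q1\<close>, \<open>P2 \<union> Q2\<close> and
  \<open>P1 \<union> Q2\<close>, \<open>P2 \<union> Q1\<close> two partitions of the same set into edges.\<close>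

lemma common_link_intersecting:
  assumes "P1 \<inter> P2 = {}" "P1 \<noteq> {}" "P2 \<noteq> {}"
    and Q1: "Q1 \<in> link E P1" "Q1 \<in> link E P2" and Q2: "Q2 \<in> link E P1" "Q2 \<in> link E P2"
    and "Q1 \<noteq> {}" "Q2 \<noteq> {}"
  shows "Q1 \<inter> Q2 \<noteq> {}"
proof
  assume disj: "Q1 \<inter> Q2 = {}"
  let ?F = "{P1 \<union> Q1, P2 \<union> Q2, P1 \<union> Q2, P2 \<union> Q1}"
  have d: "P1 \<inter> Q1 = {}" "P1 \<inter> Q2 = {}" "P2 \<inter> Q1 = {}" "P2 \<inter> Q2 = {}"
    and e: "?F \<subseteq> E"
    using Q1 Q2 by (auto simp: link_def)
  have "distinct [P1 \<union> Q1, P2 \<union> Q2, P1 \<union> Q2, P2 \<union> Q1]"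
    using assms d disj by auto
  moreover have "(P1 \<union> Q1) \<union> (P2 \<union> Q2) = (P1 \<union> Q2) \<union> (P2 \<union> Q1)"
    "(P1 \<union> Q1) \<inter> (P2 \<union> Q2) = {}" "(P1 \<union> Q2) \<inter> (P2 \<union> Q1) = {}"
    using assms(1) d disj by auto
  moreover have "?F \<subseteq> nsets UNIV r"
    using e E_sub nsets_mono[of V UNIV r] by blast
  ultimately have "?F \<in> gen_4_cycles r"
    unfolding gen_4_cycles_def by blast
  with e free show False
    unfolding gen_4_cycle_free_def by blast
qed

section \<open>Vertex covers of the sets with many extensions\<close>

lemma card_common_extensions_le_1:
  assumes "card S1 = r - 1" "card S2 = r - 1" "S1 \<inter> S2 = {}"
  shows "card (link E S1 \<inter> link E S2) \<le> 1"
proof -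
  have ne: "S1 \<noteq> {}" "S2 \<noteq> {}"
    using assms r4 by auto
  have "Q1 = Q2" if "Q1 \<in> link E S1 \<inter> link E S2" "Q2 \<in> link E S1 \<inter> link E S2" for Q1 Q2
  proof -
    have "card Q1 = 1" "card Q2 = 1"
      using that linkD(7) assms r4 by fastforce+
    then obtain x y where "Q1 = {x}" "Q2 = {y}"
      by (auto simp: card_1_singleton_iff)
    with common_link_intersecting[OF assms(3) ne, of Q1 Q2] that show ?thesis
      by auto
  qed
  then show ?thesis
    using finite_link by (simp add: card_le_Suc0_iff_eq)
qed

lemma card_extensions_le:
  assumes "card S = r - 1"
  shows "card (link E S) \<le> card V"
proof -
  have "link E S \<subseteq> nsets V 1"
    using r4 assms by (intro link_subset_nsets) auto
  then show ?thesis
    using card_mono[of "(nsets V 1)" "link E S"] finV finite_imp_finite_nsets[OF finV] by simp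
qed

text \<open>A maximal family of pairwise disjoint rich sets has at most \<open>2 / c\<^sup>2\<close> members: their extension sets have
  size at least \<open>c n\<close> and overlap in at most one element, which contradicts \<open>sum_card_squared_le\<close> for larger
  families.  By maximality the union of the family meets every rich set.\<close>

lemma rich_sets_cover:
  fixes c :: real
  assumes c: "c > 0" and K: "real K \<ge> 2 / c\<^sup>2"
  obtains U where "U \<subseteq> V" "card U \<le> r * K"
    "\<And>S. card S = r - 1 \<Longrightarrow> real (card (link E S)) \<ge> c * card V \<Longrightarrow> link E S \<noteq> {} \<Longrightarrow> S \<inter> U \<noteq> {}"
proof -
  define R where "R = {S. card S = r - 1 \<and> real (card (link E S)) \<ge> c * card V \<and> link E S \<noteq> {}}"
  have R_V: "S \<subseteq> V \<and> finite S \<and> S \<noteq> {}" if SR: "S \<in> R" for S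
  proof -
    have "link E S \<noteq> {}"
      using SR by (simp add: R_def)
    then obtain Q where Q: "Q \<in> link E S"
      by blast
    have "card S = r - 1"
      using that by (simp add: R_def)
    then have "S \<noteq> {}"
      using r4 by auto
    then show ?thesis
      using linkD(3,5)[OF Q] by blast
  qed
  have "R \<subseteq> Pow V"
    using R_V by auto
  then have finR: "finite R"
    using finV finite_subset by blast
  define MM where "MM = {M. M \<subseteq> R \<and> pairwise disjnt M}"
  have "finite MM" "{} \<in> MM"
    unfolding MM_def using finR by auto
  then have "Max (card ` MM) \<in> card ` MM"
    by (intro Max_in) auto
  then obtain M where M: "M \<in> MM" and "card M = Max (card ` MM)"
    by auto
  then have max: "card M' \<le> card M" if "M' \<in> MM" for M'
    using that \<open>finite MM\<close> by simp
  have MR: "M \<subseteq> R" and disj: "pairwise disjnt M" and finM: "finite M"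
    using M finR finite_subset by (auto simp: MM_def)
  define U where "U = \<Union>M"
  have cardU: "card U = (\<Sum>S\<in>M. card S)"
    unfolding U_def using MR R_V disj by (intro card_Union_disjoint) auto
  also have "\<dots> = card M * (r - 1)"
    using MR by (simp add: R_def subset_iff)
  finally have cardU: "card U = card M * (r - 1)" .
  have UV: "U \<subseteq> V"
    using MR R_V by (auto simp: U_def)
  have "card M * 1 \<le> card M * (r - 1)"
    using r4 by (intro mult_left_mono) auto
  also have "\<dots> \<le> card V"
    using card_mono[OF finV UV] cardU by simp
  finally have Mn: "card M \<le> card V" by simp
  have "card M \<le> K"
  proof (rule ccontr)
    assume "\<not> card M \<le> K"
    then have k: "real (card M) > 2 / c\<^sup>2"
      using K by linarith
    let ?k = "real (card M)" and ?n = "real (card V)"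
    have kpos: "?k > 0"
      using k c by (smt (verit) divide_nonneg_nonneg zero_le_power2)
    have npos: "?n > 0"
      using kpos Mn by linarith
    have "?k * (c * ?n) = (\<Sum>S\<in>M. c * ?n)"
      by simp
    also have "\<dots> \<le> (\<Sum>S\<in>M. real (card (link E S)))"
      using MR by (intro sum_mono) (auto simp: R_def)
    finally have "(?k * (c * ?n))\<^sup>2 \<le> (\<Sum>S\<in>M. real (card (link E S)))\<^sup>2"
      using c by (intro power_mono) auto
    also have "\<dots> \<le> real (card (nsets V 1)) * (\<Sum>S\<in>M. \<Sum>T\<in>M. real (card (link E S \<inter> link E T)))"
    proof (rule sum_card_squared_le)
      show "link E S \<subseteq> nsets V 1" if "S \<in> M" for S
        using that MR r4 by (intro link_subset_nsets) (auto simp: R_def)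
    qed (use finM finV finite_imp_finite_nsets in auto)
    also have "(\<Sum>S\<in>M. \<Sum>T\<in>M. real (card (link E S \<inter> link E T))) \<le> (\<Sum>S\<in>M. \<Sum>T\<in>M. 1 + (if T = S then ?n else 0))"
    proof (intro sum_mono)
      fix S T assume ST: "S \<in> M" "T \<in> M"
      show "real (card (link E S \<inter> link E T)) \<le> 1 + (if T = S then ?n else 0)"
      proof (cases "T = S")
        case True
        then show ?thesis
          using card_extensions_le[of S] ST MR by (auto simp: R_def subset_iff)
      next
        case False
        then have "S \<inter> T = {}"
          using disj ST by (auto simp: pairwise_def disjnt_def)
        then show ?thesis
          using card_common_extensions_le_1[of S T] False ST MR by (auto simp: R_def)
      qed
    qed
    also have "(\<Sum>S\<in>M. \<Sum>T\<in>M. 1 + (if T = S then ?n else 0)) = ?k * (?k + ?n)"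
      using finM by (simp add: sum.distrib)
    finally have "(?k * (c * ?n))\<^sup>2 \<le> ?n * (?k * (?k + ?n))"
      using finV by (simp add: mult_left_mono)
    then have "(?k * ?n) * (?k * c\<^sup>2 * ?n) \<le> (?k * ?n) * (?k + ?n)"
      by (simp add: power2_eq_square algebra_simps)
    then have "?k * c\<^sup>2 * ?n \<le> ?k + ?n"
      using kpos npos by (simp add: mult_le_cancel_left)
    moreover have "?k * c\<^sup>2 > 2"
      using k c by (simp add: field_simps)
    then have "?k * c\<^sup>2 * ?n > 2 * ?n"
      using npos by simp
    ultimately show False
      using Mn by linarith
  qed
  then have "card M * (r - 1) \<le> K * r"
    by (intro mult_mono) auto
  with cardU have "card U \<le> r * K"
    by (simp add: mult.commute)
  moreover have "S \<inter> U \<noteq> {}" if "card S = r - 1" "real (card (link E S)) \<ge> c * card V" "link E S \<noteq> {}" for S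
  proof
    assume SU: "S \<inter> U = {}"
    have SR: "S \<in> R"
      using that by (simp add: R_def)
    have "S \<notin> M"
      using R_V[OF SR] SU by (auto simp: U_def)
    moreover have "insert S M \<in> MM"
      using SR MR disj SU unfolding MM_def U_def by (auto simp: pairwise_insert disjnt_def)
    then have "card (insert S M) \<le> card M"
      by (rule max)
    ultimately show False
      using finM by simp
  qed
  ultimately show ?thesis
    using that UV by blast
qed

section \<open>Centres of common links\<close>

text \<open>Each edge through \<open>T\<close> arises by choosing \<open>r - 4\<close> further vertices and then extending the resulting
  \<open>(r-1)\<close>-set; only the last choice is restricted.\<close>

lemma triple_degree_le:
  fixes c :: real
  assumes "c \<ge> 0" and cod: "\<And>S. card S = r - 1 \<Longrightarrow> real (card (link E S)) \<le> c * card V"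
    and T: "card T = 3"
  shows "real (card {A \<in> E. T \<subseteq> A}) \<le> c * real (card V) ^ (r - 3)"
proof -
  let ?R = "{R \<in> nsets V (r - 4). R \<inter> T = {}}"
  have finT: "finite T"
    using T by (metis card.infinite zero_neq_numeral)
  have finR: "finite ?R"
    using finite_nsets_V by simp
  have "{A \<in> E. T \<subseteq> A} \<subseteq> (\<Union>R\<in>?R. (\<lambda>q. (T \<union> R) \<union> q) ` link E (T \<union> R))"
  proof
    fix A assume "A \<in> {A \<in> E. T \<subseteq> A}"
    then have A: "A \<in> E" "T \<subseteq> A" "A \<subseteq> V" "finite A" "card A = r"
      using edgeD[of A] by simp_all
    then have "card (A - T) = r - 3"
      using T finT by (simp add: card_Diff_subset)
    then have "card (A - T) > 0"
      using r4 by simp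
    then obtain a where a: "a \<in> A - T"
      by (metis card_gt_0_iff ex_in_conv)
    let ?S = "A - T - {a}"
    have "card ?S = r - 4"
      using a \<open>card (A - T) = r - 3\<close> A by simp
    then have "?S \<in> ?R"
      using A by (auto simp: nsets_def)
    moreover have "A = (T \<union> ?S) \<union> {a}" "{a} \<in> link E (T \<union> ?S)"
    proof -
      show eq: "A = (T \<union> ?S) \<union> {a}"
        using a A by auto
      show "{a} \<in> link E (T \<union> ?S)"
        using a A(1) eq unfolding link_def by auto
    qed
    ultimately show "A \<in> (\<Union>R\<in>?R. (\<lambda>q. (T \<union> R) \<union> q) ` link E (T \<union> R))"
      by blast
  qed
  then have "card {A \<in> E. T \<subseteq> A} \<le> card (\<Union>R\<in>?R. (\<lambda>q. (T \<union> R) \<union> q) ` link E (T \<union> R))"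
    using finR finite_link by (intro card_mono) auto
  also have "\<dots> \<le> (\<Sum>R\<in>?R. card ((\<lambda>q. (T \<union> R) \<union> q) ` link E (T \<union> R)))"
    by (rule card_UN_le[OF finR])
  also have "\<dots> \<le> (\<Sum>R\<in>?R. card (link E (T \<union> R)))"
    by (intro sum_mono card_image_le finite_link)
  finally have "real (card {A \<in> E. T \<subseteq> A}) \<le> (\<Sum>R\<in>?R. real (card (link E (T \<union> R))))"
    by (simp only: of_nat_le_iff flip: of_nat_sum)
  also have "\<dots> \<le> (\<Sum>R\<in>?R. c * card V)"
  proof (intro sum_mono cod)
    fix R assume "R \<in> ?R"
    then show "card (T \<union> R) = r - 1"
      using T finT r4 by (subst card_Un_disjoint) (auto simp: nsets_def)
  qed
  also have "\<dots> = real (card ?R) * (c * card V)"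
    by simp
  also have "\<dots> \<le> real (card V ^ (r - 4)) * (c * card V)"
  proof (intro mult_right_mono)
    have "card ?R \<le> card (nsets V (r - 4))"
      using finite_nsets_V by (intro card_mono) auto
    also have "\<dots> \<le> card V ^ (r - 4)"
      by (rule card_nsets_le_power[OF finV])
    finally show "real (card ?R) \<le> real (card V ^ (r - 4))"
      by (rule of_nat_mono)
  qed (use assms in auto)
  also have "\<dots> = c * real (card V) ^ (r - 3)"
  proof -
    have "r - 3 = Suc (r - 4)"
      using r4 by simp
    then show ?thesis by simp
  qed
  finally show ?thesis .
qed

lemma card_link_through_le:
  assumes D: "\<And>T. card T = 3 \<Longrightarrow> real (card {A \<in> E. T \<subseteq> A}) \<le> D"
    and "card Q = 2" "y \<notin> Q"
  shows "real (card {P \<in> link E Q. y \<in> P}) \<le> D"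
proof -
  have "inj_on ((\<union>) Q) {P \<in> link E Q. y \<in> P}"
    by (intro inj_onI) (auto simp: link_def)
  moreover have "(\<union>) Q ` {P \<in> link E Q. y \<in> P} \<subseteq> {A \<in> E. insert y Q \<subseteq> A}"
    by (auto simp: link_def)
  ultimately have "card {P \<in> link E Q. y \<in> P} \<le> card {A \<in> E. insert y Q \<subseteq> A}"
    using finE by (intro card_inj_on_le[of "(\<union>) Q"]) auto
  moreover have "finite Q"
    using assms(2) by (metis card.infinite zero_neq_numeral)
  then have "card (insert y Q) = 3"
    using assms by simp
  ultimately show ?thesis
    using D by fastforce
qed

text \<open>In an intersecting family without a common element, each member meets a fixed member \<open>S0\<close> in some \<open>q\<close> and
  also a member that omits \<open>q\<close>.  So it contains one of at most \<open>r\<^sup>2\<close> pairs, and together with \<open>x\<close> one of as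
  many triples, which have small degree.\<close>

lemma common_link_without_center_le:
  assumes D: "\<And>T. card T = 3 \<Longrightarrow> real (card {A \<in> E. T \<subseteq> A}) \<le> D"
    and "x \<noteq> y" and nc: "\<And>z. \<exists>S \<in> link E {x} \<inter> link E {y}. z \<notin> S"
  shows "real (card (link E {x} \<inter> link E {y})) \<le> real r ^ 2 * D"
proof -
  let ?F = "link E {x} \<inter> link E {y}"
  obtain S0 where S0: "S0 \<in> ?F"
    using nc by blast
  obtain g where g: "\<And>z. g z \<in> ?F" "\<And>z. z \<notin> g z"
    using nc by metis
  have F: "finite S" "card S \<le> r" "x \<notin> S" if "S \<in> ?F" for S
    using that linkD[of S "{x}"] by auto
  \<comment> \<open>The bound \<open>D\<close> is known to be nonnegative only because some triple exists.\<close>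
  have D0: "D \<ge> 0"
  proof -
    have "\<exists>T::'a set. card T = 3"
    proof -
      have "card S0 = r - 1"
        using S0 linkD(7)[of S0 "{x}"] by auto
      then show ?thesis
        using r4 by (metis diff_le_mono numeral_3_eq_3 numeral_eq_Suc obtain_subset_with_card_n pred_numeral_simps(2) semiring_norm(26) semiring_norm(27) diff_Suc_1)
    qed
    then show ?thesis
      using D of_nat_0_le_iff order_trans by blast
  qed
  let ?G = "\<lambda>q q'. {S \<in> ?F. q \<in> S \<and> q' \<in> S}"
  have G: "real (card (?G q q')) \<le> D" if "q \<in> S0" "q' \<in> g q" for q q'
  proof -
    have "q \<noteq> x" "q' \<noteq> x" "q \<noteq> q'"
      using F(3)[OF S0] F(3)[OF g(1), of q] g(2)[of q] that by auto
    then have "card {x, q} = 2" "q' \<notin> {x, q}"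
      by auto
    have "inj_on (insert x) (?G q q')"
      using F(3) by (intro inj_onI) (metis (no_types, lifting) insert_ident mem_Collect_eq)
    moreover have "insert x ` ?G q q' \<subseteq> {A \<in> E. {x, q, q'} \<subseteq> A}"
      by (auto simp: link_def)
    ultimately have "card (?G q q') \<le> card {A \<in> E. {x, q, q'} \<subseteq> A}"
      using finE by (intro card_inj_on_le[of "insert x"]) auto
    moreover have "card {x, q, q'} = 3"
      using \<open>q \<noteq> x\<close> \<open>q' \<noteq> x\<close> \<open>q \<noteq> q'\<close> by auto
    ultimately show ?thesis
      using D by fastforce
  qed
  have "?F \<subseteq> (\<Union>q\<in>S0. \<Union>q'\<in>g q. ?G q q')"
  proof
    fix S assume S: "S \<in> ?F"
    have ne: "S' \<noteq> {}" if "S' \<in> ?F" for S'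
      using linkD(7)[of S' "{x}"] that r4 by auto
    have meet: "S \<inter> S' \<noteq> {}" if "S' \<in> ?F" for S'
      using common_link_intersecting[of "{x}" "{y}" S S'] that S ne assms(2) by auto
    obtain q where q: "q \<in> S" "q \<in> S0"
      using meet[OF S0] by auto
    moreover obtain q' where "q' \<in> S" "q' \<in> g q"
      using meet[OF g(1)] by auto
    ultimately show "S \<in> (\<Union>q\<in>S0. \<Union>q'\<in>g q. ?G q q')"
      using S by blast
  qed
  then have "card ?F \<le> card (\<Union>q\<in>S0. \<Union>q'\<in>g q. ?G q q')"
    using F(1)[OF S0] F(1)[OF g(1)] finite_link by (intro card_mono) auto
  also have "\<dots> \<le> (\<Sum>q\<in>S0. card (\<Union>q'\<in>g q. ?G q q'))"
    by (rule card_UN_le[OF F(1)[OF S0]])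
  also have "\<dots> \<le> (\<Sum>q\<in>S0. \<Sum>q'\<in>g q. card (?G q q'))"
    by (intro sum_mono card_UN_le F(1) g(1))
  finally have "real (card ?F) \<le> (\<Sum>q\<in>S0. \<Sum>q'\<in>g q. real (card (?G q q')))"
    by (simp only: of_nat_le_iff flip: of_nat_sum)
  also have "\<dots> \<le> (\<Sum>q\<in>S0. \<Sum>q'\<in>g q. D)"
    by (intro sum_mono G)
  also have "\<dots> = (\<Sum>q\<in>S0. real (card (g q)) * D)"
    by simp
  also have "\<dots> \<le> (\<Sum>q\<in>S0. real r * D)"
    using F(2)[OF g(1)] D0 by (intro sum_mono mult_right_mono) auto
  also have "\<dots> = real (card S0) * (real r * D)"
    by simp
  also have "\<dots> \<le> real r * (real r * D)"
    using F(2)[OF S0] D0 by (intro mult_right_mono) auto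
  finally show ?thesis
    by (simp add: power2_eq_square mult.assoc)
qed

text \<open>All edges that contribute to a common link without a common element are deleted, at a cost that is small
  when triples have small degree.  What remains of every common link of two vertices has a common element,
  and \<open>ctr\<close> chooses one.\<close>

lemma centered_subgraph:
  assumes D: "\<And>T. card T = 3 \<Longrightarrow> real (card {A \<in> E. T \<subseteq> A}) \<le> D" and D0: "D \<ge> 0"
  obtains E' ctr where "E' \<subseteq> E"
    "real (card E) \<le> real (card E') + real (card V) ^ 2 * (real r ^ 2 * D)"
    "\<And>x y S. x \<noteq> y \<Longrightarrow> S \<in> link E' {x} \<Longrightarrow> S \<in> link E' {y} \<Longrightarrow> ctr x y \<in> S"
proof -
  let ?F = "\<lambda>x y. link E {x} \<inter> link E {y}"
  define bad where "bad = {(x, y) \<in> V \<times> V. x \<noteq> y \<and> (\<forall>z. \<exists>S \<in> ?F x y. z \<notin> S)}"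
  define X where "X = (\<Union>(x, y)\<in>bad. insert x ` ?F x y)"
  define E' where "E' = E - X"
  have badV: "bad \<subseteq> V \<times> V" "finite bad"
    using finV by (auto simp: bad_def intro: finite_subset[of _ "V \<times> V"])
  have XE: "X \<subseteq> E"
    by (auto simp: X_def link_def)
  have "card X \<le> (\<Sum>p\<in>bad. card (case p of (x, y) \<Rightarrow> insert x ` ?F x y))"
    unfolding X_def by (rule card_UN_le[OF badV(2)])
  also have "\<dots> \<le> (\<Sum>p\<in>bad. card (?F (fst p) (snd p)))"
    by (intro sum_mono) (auto simp: split_beta intro!: card_image_le finite_link)
  finally have "real (card X) \<le> (\<Sum>p\<in>bad. real (card (?F (fst p) (snd p))))"
    by (simp only: of_nat_le_iff flip: of_nat_sum)
  also have "\<dots> \<le> (\<Sum>p\<in>bad. real r ^ 2 * D)"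
  proof (rule sum_mono)
    fix p assume "p \<in> bad"
    then show "real (card (?F (fst p) (snd p))) \<le> real r ^ 2 * D"
      by (intro common_link_without_center_le[OF D]) (auto simp: bad_def)
  qed
  also have "\<dots> = real (card bad) * (real r ^ 2 * D)"
    by simp
  also have "\<dots> \<le> real (card V) ^ 2 * (real r ^ 2 * D)"
  proof (intro mult_right_mono)
    have "card bad \<le> card (V \<times> V)"
      using finV badV by (intro card_mono) auto
    then show "real (card bad) \<le> real (card V) ^ 2"
      by (simp add: card_cartesian_product power2_eq_square flip: of_nat_mult)
  qed (use D0 in auto)
  finally have X: "real (card X) \<le> real (card V) ^ 2 * (real r ^ 2 * D)" .
  have "card E = card E' + card X"
    using XE finE finite_subset[OF XE] card_mono[OF finE XE] unfolding E'_def by (simp add: card_Diff_subset)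
  then have "real (card E) \<le> real (card E') + real (card V) ^ 2 * (real r ^ 2 * D)"
    using X by simp
  moreover define ctr where "ctr = (\<lambda>x y. SOME z. \<forall>S \<in> link E' {x} \<inter> link E' {y}. z \<in> S)"
  have "ctr x y \<in> S" if xy: "x \<noteq> y" and S: "S \<in> link E' {x}" "S \<in> link E' {y}" for x y S
  proof -
    have E'E: "E' \<subseteq> E"
      by (auto simp: E'_def)
    have SF: "S \<in> ?F x y"
      using S link_mono[OF E'E] by blast
    have V: "x \<in> V" "y \<in> V"
      using SF linkD(5) by auto
    have "insert x S \<notin> X"
      using S(1) by (auto simp: E'_def link_def)
    then have "(x, y) \<notin> bad"
      using SF unfolding X_def by blast
    then obtain z where "\<forall>S \<in> ?F x y. z \<in> S"
      using xy V unfolding bad_def by blast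
    then have "\<forall>S \<in> link E' {x} \<inter> link E' {y}. z \<in> S"
      using link_mono[OF E'E] by blast
    then have "\<forall>S \<in> link E' {x} \<inter> link E' {y}. ctr x y \<in> S"
      unfolding ctr_def by (rule someI)
    with S show ?thesis by blast
  qed
  ultimately show ?thesis
    using that[of E' ctr] unfolding E'_def by blast
qed

section \<open>The weighted count of links of pairs\<close>

text \<open>These are the pairs of link members to which \<open>common_link_intersecting\<close> does not apply.  They are few as
  soon as the triples have small degree.\<close>

definition crossing_pairs :: "'a set \<Rightarrow> ('a set \<times> 'a set) set" where
  "crossing_pairs Q = {(P1, P2) \<in> link E Q \<times> link E Q. P1 \<inter> P2 \<noteq> {}}"

lemma finite_crossing_pairs: "finite (crossing_pairs Q)"
  unfolding crossing_pairs_def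
  by (rule finite_subset[of _ "link E Q \<times> link E Q"]) (auto simp: finite_link)

lemma card_crossing_pairs_le:
  assumes D: "\<And>T. card T = 3 \<Longrightarrow> real (card {A \<in> E. T \<subseteq> A}) \<le> D" and D0: "D \<ge> 0"
    and Q: "card Q = 2"
  shows "real (card (crossing_pairs Q)) \<le> real (card (link E Q)) * (real r * D)"
proof -
  let ?C = "\<lambda>P y. {P' \<in> link E Q. y \<in> P'}"
  have "crossing_pairs Q \<subseteq> (\<Union>P\<in>link E Q. \<Union>y\<in>P. Pair P ` ?C P y)"
    unfolding crossing_pairs_def by blast
  moreover have finP: "finite P" if "P \<in> link E Q" for P
    using linkD(4)[OF that] .
  ultimately have "card (crossing_pairs Q) \<le> card (\<Union>P\<in>link E Q. \<Union>y\<in>P. Pair P ` ?C P y)"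
    using finite_link by (intro card_mono) auto
  also have "\<dots> \<le> (\<Sum>P\<in>link E Q. card (\<Union>y\<in>P. Pair P ` ?C P y))"
    by (rule card_UN_le[OF finite_link])
  also have "\<dots> \<le> (\<Sum>P\<in>link E Q. \<Sum>y\<in>P. card (Pair P ` ?C P y))"
    by (intro sum_mono card_UN_le finP)
  also have "\<dots> \<le> (\<Sum>P\<in>link E Q. \<Sum>y\<in>P. card (?C P y))"
    using finite_link by (intro sum_mono card_image_le) auto
  finally have "real (card (crossing_pairs Q)) \<le> (\<Sum>P\<in>link E Q. \<Sum>y\<in>P. real (card (?C P y)))"
    by (simp only: of_nat_le_iff flip: of_nat_sum)
  also have "\<dots> \<le> (\<Sum>P\<in>link E Q. \<Sum>y\<in>P. D)"
  proof (intro sum_mono)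
    fix P y assume "P \<in> link E Q" "y \<in> P"
    then have "y \<notin> Q"
      using linkD(1) by blast
    then show "real (card (?C P y)) \<le> D"
      by (intro card_link_through_le D Q)
  qed
  also have "\<dots> = (\<Sum>P\<in>link E Q. real (card P) * D)"
    by simp
  also have "\<dots> \<le> (\<Sum>P\<in>link E Q. real r * D)"
  proof (intro sum_mono mult_right_mono D0)
    show "real (card P) \<le> real r" if "P \<in> link E Q" for P
      using linkD(7)[OF that] by simp
  qed
  finally show ?thesis
    by simp
qed

lemma sum_crossing_pairs_le:
  assumes D: "\<And>T. card T = 3 \<Longrightarrow> real (card {A \<in> E. T \<subseteq> A}) \<le> D" and D0: "D \<ge> 0"
  shows "(\<Sum>Q\<in>nsets V 2. real (card (crossing_pairs Q))) \<le> real (card E) * (real r ^ 3 * D)"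
proof -
  have "(\<Sum>Q\<in>nsets V 2. real (card (crossing_pairs Q))) \<le> (\<Sum>Q\<in>nsets V 2. real (card (link E Q)) * (real r * D))"
    by (intro sum_mono card_crossing_pairs_le[OF D D0]) (auto simp: nsets_def)
  also have "\<dots> = real (\<Sum>Q\<in>nsets V 2. card (link E Q)) * (real r * D)"
    by (simp add: sum_distrib_right)
  also have "\<dots> = real (card E * (r choose 2)) * (real r * D)"
    by (simp only: sum_card_link)
  also have "\<dots> \<le> real (card E * r ^ 2) * (real r * D)"
  proof (intro mult_right_mono of_nat_mono mult_left_mono)
    show "(r choose 2) \<le> r ^ 2"
      using binomial_fact_pow[of r 2] by (simp add: fact_2)
  qed (use D0 in auto)
  also have "\<dots> = real (card E) * (real r ^ 3 * D)"
    by (simp add: power2_eq_square power3_eq_cube)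
  finally show ?thesis .
qed

text \<open>The count behind the Kovari-Sos-Turan theorem: the squares of the weighted link sizes of the pairs \<open>Q\<close>
  count, up to crossing pairs, triples \<open>(Q, P1, P2)\<close> with disjoint \<open>P1\<close>, \<open>P2\<close> in the link of \<open>Q\<close>.  For fixed
  \<open>P1\<close>, \<open>P2\<close> the number of choices of \<open>Q\<close> need not be bounded, so \<open>Q\<close> is counted with the weight \<open>1 / k Q\<close>, where
  \<open>k Q\<close> bounds the size of every common link containing \<open>Q\<close>.  Then each \<open>(P1, P2)\<close> contributes at most its
  weight, and by Cauchy-Schwarz the price is the factor \<open>\<Sum>Q. k Q\<close>.  This sum is at most
  \<open>3/2 n\<^sup>2\<close>, because two pairs \<open>{z, w}\<close>, \<open>{z, w'}\<close> in a common link are determined by \<open>(w, w')\<close>: the shared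
  element is \<open>ctr w w'\<close>.\<close>

lemma weighted_link_count:
  fixes u :: "'a set \<Rightarrow> real"
  assumes u: "\<And>P. 0 \<le> u P" "\<And>P. u P \<le> 1"
    and ctr: "\<And>x y S. x \<noteq> y \<Longrightarrow> S \<in> link E {x} \<Longrightarrow> S \<in> link E {y} \<Longrightarrow> ctr x y \<in> S"
  shows "(\<Sum>Q\<in>nsets V 2. \<Sum>P\<in>link E Q. u P)\<^sup>2
    \<le> 3 / 2 * real (card V) ^ 2 *
      ((\<Sum>P\<in>nsets V (r - 2). u P)\<^sup>2 + (\<Sum>Q\<in>nsets V 2. real (card (crossing_pairs Q))))"
proof -
  define T where "T = (\<lambda>(w, w'). ({ctr w w', w}, {ctr w w', w'})) ` (V \<times> V)"
  define k where "k Q = 1 + real (card (T `` {Q}))" for Q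
  define U where "U Q = (\<Sum>P\<in>link E Q. u P)" for Q
  let ?N2 = "nsets V 2" and ?N = "nsets V (r - 2)"
  have finT: "finite T"
    unfolding T_def using finV by simp
  have k1: "k Q \<ge> 1" for Q
    by (simp add: k_def)
  \<comment> \<open>\<open>Q\<close> and \<open>Q'\<close> share some \<open>z\<close>, and \<open>insert z P1\<close>, \<open>insert z P2\<close> are common neighbours of \<open>w\<close> and \<open>w'\<close>
      that meet only in \<open>z\<close>; hence \<open>z\<close> is the centre.\<close>
  have T: "(Q, Q') \<in> T"
    if P: "P1 \<inter> P2 = {}" and Q: "P1 \<in> link E Q" "P2 \<in> link E Q" "P1 \<in> link E Q'" "P2 \<in> link E Q'"
      and card: "card Q = 2" "card Q' = 2" and "Q \<noteq> Q'" for P1 P2 Q Q'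
  proof -
    have "P1 \<noteq> {}" "P2 \<noteq> {}"
      using Q(1,2) linkD(7) card r4 by fastforce+
    moreover have "Q \<noteq> {}" "Q' \<noteq> {}"
      using card by auto
    ultimately have "Q \<inter> Q' \<noteq> {}"
      using common_link_intersecting[OF P] Q link_commute by blast
    then obtain z where z: "z \<in> Q" "z \<in> Q'"
      by blast
    obtain w where w: "Q = {z, w}" "w \<noteq> z"
      using z card by (auto simp: card_2_iff)
    obtain w' where w': "Q' = {z, w'}" "w' \<noteq> z"
      using z card by (auto simp: card_2_iff)
    have ww': "w \<noteq> w'"
      using w w' \<open>Q \<noteq> Q'\<close> by auto
    have "ctr w w' \<in> insert z P" if "P \<in> link E Q" "P \<in> link E Q'" for P
    proof (rule ctr[OF ww'])
      show "insert z P \<in> link E {w}" "insert z P \<in> link E {w'}"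
        using that w w' by (auto simp: link_def insert_commute)
    qed
    then have "ctr w w' = z"
      using P Q by blast
    moreover have "w \<in> V" "w' \<in> V"
      using linkD(5)[OF Q(1)] linkD(5)[OF Q(3)] w w' by auto
    ultimately show ?thesis
      unfolding T_def using w w' by (intro image_eqI[of _ _ "(w, w')"]) auto
  qed
  have inner: "(\<Sum>Q | Q \<in> ?N2 \<and> P1 \<in> link E Q \<and> P2 \<in> link E Q. 1 / k Q) \<le> 1"
    if P: "P1 \<inter> P2 = {}" for P1 P2
  proof -
    let ?F = "{Q. Q \<in> ?N2 \<and> P1 \<in> link E Q \<and> P2 \<in> link E Q}"
    have finF: "finite ?F"
      using finite_nsets_V by simp
    have "1 / k Q \<le> 1 / real (card ?F)" if Q: "Q \<in> ?F" for Q
    proof -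
      have "?F \<subseteq> insert Q (T `` {Q})"
        using T[OF P] Q by (auto simp: nsets_def)
      then have "card ?F \<le> card (insert Q (T `` {Q}))"
        using finT by (intro card_mono) (auto simp: finite_Image)
      also have "\<dots> \<le> 1 + card (T `` {Q})"
        by (simp add: card_insert_le_m1 card_insert_if finT)
      finally have "real (card ?F) \<le> k Q"
        unfolding k_def by linarith
      moreover have "card ?F > 0"
        using Q finF by (auto simp: card_gt_0_iff)
      ultimately show ?thesis
        by (intro divide_left_mono) auto
    qed
    then have "(\<Sum>Q\<in>?F. 1 / k Q) \<le> (\<Sum>Q\<in>?F. 1 / real (card ?F))"
      by (rule sum_mono)
    also have "\<dots> \<le> 1"
      by simp
    finally show ?thesis .
  qed
  have sum_k: "(\<Sum>Q\<in>?N2. k Q) \<le> 3 / 2 * real (card V) ^ 2"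
  proof -
    have "(\<Sum>Q\<in>?N2. card (T `` {Q})) = card (SIGMA Q:?N2. T `` {Q})"
      using finite_nsets_V finT by (intro card_SigmaI[symmetric]) (auto simp: finite_Image)
    also have "\<dots> \<le> card T"
      using finT by (intro card_mono) auto
    also have "\<dots> \<le> card (V \<times> V)"
      unfolding T_def using finV by (intro card_image_le) auto
    finally have "real (\<Sum>Q\<in>?N2. card (T `` {Q})) \<le> real (card V) ^ 2"
      unfolding card_cartesian_product power2_eq_square of_nat_mult[symmetric] by (rule of_nat_mono)
    moreover have "real (card ?N2) \<le> real (card V) ^ 2 / 2"
    proof -
      have "2 * (card V choose 2) \<le> card V ^ 2"
        using binomial_fact_pow[of "card V" 2] by (simp add: fact_2)
      then have "2 * real (card V choose 2) \<le> real (card V) ^ 2"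
        by (metis of_nat_le_iff of_nat_mult of_nat_numeral of_nat_power)
      then show ?thesis
        using finV by simp
    qed
    ultimately show ?thesis
      by (simp add: k_def sum.distrib)
  qed
  have N: "link E Q \<subseteq> ?N" if "Q \<in> ?N2" for Q
    using that r4 by (intro link_subset_nsets) (auto simp: nsets_def)
  let ?DD = "{(P1, P2) \<in> ?N \<times> ?N. P1 \<inter> P2 = {}}"
  have finDD: "finite ?DD"
    by (rule finite_subset[of _ "?N \<times> ?N"]) (auto simp: finite_nsets_V)
  let ?uu = "\<lambda>p. u (fst p) * u (snd p)"
  have uu: "0 \<le> ?uu p" "?uu p \<le> 1" for p
    using u by (auto simp: mult_le_one)
  have U_sq: "(U Q)\<^sup>2 / k Q \<le> (\<Sum>p | p \<in> ?DD \<and> fst p \<in> link E Q \<and> snd p \<in> link E Q. ?uu p / k Q)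
      + real (card (crossing_pairs Q))" if Q: "Q \<in> ?N2" for Q
  proof -
    let ?D = "{p. p \<in> ?DD \<and> fst p \<in> link E Q \<and> snd p \<in> link E Q}"
    have "(U Q)\<^sup>2 / k Q = (\<Sum>p\<in>link E Q \<times> link E Q. ?uu p / k Q)"
      by (simp add: U_def power2_eq_square sum_product sum.cartesian_product split_beta sum_divide_distrib)
    also have "link E Q \<times> link E Q = ?D \<union> crossing_pairs Q"
      using N[OF Q] by (auto simp: crossing_pairs_def)
    also have "(\<Sum>p\<in>?D \<union> crossing_pairs Q. ?uu p / k Q) = (\<Sum>p\<in>?D. ?uu p / k Q) + (\<Sum>p\<in>crossing_pairs Q. ?uu p / k Q)"
      using finDD finite_crossing_pairs by (intro sum.union_disjoint) (auto simp: crossing_pairs_def)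
    also have "(\<Sum>p\<in>crossing_pairs Q. ?uu p / k Q) \<le> (\<Sum>p\<in>crossing_pairs Q. 1)"
    proof (rule sum_mono)
      fix p
      show "?uu p / k Q \<le> 1"
        using uu(2)[of p] k1[of Q] by (simp add: divide_le_eq_1)
    qed
    finally show ?thesis by simp
  qed
  have "(\<Sum>Q\<in>?N2. U Q)\<^sup>2 = (\<Sum>Q\<in>?N2. sqrt (k Q) * (U Q / sqrt (k Q)))\<^sup>2"
    using k1 by (metis (no_types, lifting) less_le_not_le nonzero_mult_div_cancel_left not_one_le_zero order_trans real_sqrt_eq_zero_cancel_iff times_divide_eq_right)
  also have "\<dots> \<le> (\<Sum>Q\<in>?N2. (sqrt (k Q))\<^sup>2) * (\<Sum>Q\<in>?N2. (U Q / sqrt (k Q))\<^sup>2)"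
    by (rule Cauchy_Schwarz_ineq_sum)
  also have "\<dots> = (\<Sum>Q\<in>?N2. k Q) * (\<Sum>Q\<in>?N2. (U Q)\<^sup>2 / k Q)"
  proof -
    have "k Q \<ge> 0" for Q
      using k1[of Q] by linarith
    then show ?thesis
      by (simp add: power_divide)
  qed
  also have "\<dots> \<le> (3 / 2 * real (card V) ^ 2) * ((\<Sum>P\<in>?N. u P)\<^sup>2 + (\<Sum>Q\<in>?N2. real (card (crossing_pairs Q))))"
  proof (rule mult_mono[OF sum_k])
    have "(\<Sum>Q\<in>?N2. (U Q)\<^sup>2 / k Q) \<le>
      (\<Sum>Q\<in>?N2. (\<Sum>p | p \<in> ?DD \<and> fst p \<in> link E Q \<and> snd p \<in> link E Q. ?uu p / k Q) + real (card (crossing_pairs Q)))"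
      by (intro sum_mono U_sq)
    also have "\<dots> = (\<Sum>Q\<in>?N2. \<Sum>p | p \<in> ?DD \<and> fst p \<in> link E Q \<and> snd p \<in> link E Q. ?uu p / k Q)
        + (\<Sum>Q\<in>?N2. real (card (crossing_pairs Q)))"
      by (rule sum.distrib)
    also have "(\<Sum>Q\<in>?N2. \<Sum>p | p \<in> ?DD \<and> fst p \<in> link E Q \<and> snd p \<in> link E Q. ?uu p / k Q)
        = (\<Sum>p\<in>?DD. \<Sum>Q | Q \<in> ?N2 \<and> fst p \<in> link E Q \<and> snd p \<in> link E Q. ?uu p / k Q)"
      by (rule sum.swap_restrict[OF finite_nsets_V finDD])
    also have "\<dots> = (\<Sum>p\<in>?DD. ?uu p * (\<Sum>Q | Q \<in> ?N2 \<and> fst p \<in> link E Q \<and> snd p \<in> link E Q. 1 / k Q))"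
      by (simp add: sum_distrib_left)
    also have "\<dots> \<le> (\<Sum>p\<in>?DD. ?uu p * 1)"
    proof (intro sum_mono mult_left_mono)
      fix p assume "p \<in> ?DD"
      then have "fst p \<inter> snd p = {}"
        by auto
      then show "(\<Sum>Q | Q \<in> ?N2 \<and> fst p \<in> link E Q \<and> snd p \<in> link E Q. 1 / k Q) \<le> 1"
        by (rule inner)
    qed (rule uu)
    also have "\<dots> \<le> (\<Sum>p\<in>?N \<times> ?N. ?uu p * 1)"
      using uu(1) finite_nsets_V by (intro sum_mono2) auto
    also have "\<dots> = (\<Sum>P\<in>?N. u P)\<^sup>2"
      by (simp add: power2_eq_square sum_product sum.cartesian_product split_beta)
    finally show "(\<Sum>Q\<in>?N2. (U Q)\<^sup>2 / k Q) \<le> (\<Sum>P\<in>?N. u P)\<^sup>2 + (\<Sum>Q\<in>?N2. real (card (crossing_pairs Q)))"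
      by simp
    show "0 \<le> (\<Sum>Q\<in>?N2. (U Q)\<^sup>2 / k Q)"
    proof (rule sum_nonneg)
      fix Q
      show "0 \<le> (U Q)\<^sup>2 / k Q"
        using k1[of Q] by simp
    qed
  qed auto
  finally show ?thesis
    by (simp add: U_def)
qed

section \<open>Stars with centres in a small set\<close>

definition star :: "'a set \<Rightarrow> 'a \<Rightarrow> 'a set set" where
  "star W v = {S \<in> nsets V (r - 1). S \<inter> W = {} \<and> insert v S \<in> E}"

definition stars :: "'a set \<Rightarrow> 'a set set" where
  "stars W = (\<Union>v\<in>W. star W v)"

definition completions :: "'a set set \<Rightarrow> 'a set \<Rightarrow> 'a set" where
  "completions F P = {w \<in> V. w \<notin> P \<and> insert w P \<in> F}"

lemma finite_star: "finite (star W v)"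
  unfolding star_def using finite_nsets_V by simp

lemma stars_subset: "stars W \<subseteq> nsets V (r - 1)"
  by (auto simp: stars_def star_def)

lemma finite_stars: "finite (stars W)"
  using stars_subset finite_nsets_V finite_subset by blast

lemma finite_completions: "finite (completions F P)"
  unfolding completions_def using finV by simp

lemma card_completions_le: "card (completions F P) \<le> card V"
  unfolding completions_def using finV by (intro card_mono) auto

lemma star_linkD:
  assumes "v \<in> W" "S \<in> star W v"
  shows "S \<in> link E {v}"
  using assms by (auto simp: star_def link_def)

lemma card_completions_stars_le:
  assumes "finite W"
  shows "card (completions (stars W) P) \<le> (\<Sum>v\<in>W. card (completions (star W v) P))"
proof -
  have "completions (stars W) P = (\<Union>v\<in>W. completions (star W v) P)"
    by (auto simp: completions_def stars_def)
  then show ?thesis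
    using card_UN_le[OF assms] by simp
qed

text \<open>Both sides count the pairs of a member of \<open>F\<close> and an element of it to be removed.\<close>

lemma sum_card_completions:
  assumes "F \<subseteq> nsets V (r - 1)"
  shows "(\<Sum>P\<in>nsets V (r - 2). card (completions F P)) = (r - 1) * card F"
proof -
  have "card (completions F P) = card {S \<in> F. P \<subseteq> S}" if P: "P \<in> nsets V (r - 2)" for P
  proof (rule bij_betw_same_card[of "\<lambda>w. insert w P"])
    show "bij_betw (\<lambda>w. insert w P) (completions F P) {S \<in> F. P \<subseteq> S}"
      unfolding bij_betw_def
    proof
      show "inj_on (\<lambda>w. insert w P) (completions F P)"
        by (intro inj_onI) (auto simp: completions_def)
      show "(\<lambda>w. insert w P) ` completions F P = {S \<in> F. P \<subseteq> S}"
      proof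
        show "{S \<in> F. P \<subseteq> S} \<subseteq> (\<lambda>w. insert w P) ` completions F P"
        proof
          fix S assume S: "S \<in> {S \<in> F. P \<subseteq> S}"
          then have S': "S \<subseteq> V" "finite S" "card S = r - 1" "P \<subseteq> S" "finite P" "card P = r - 2"
            using assms P by (auto simp: nsets_def)
          then have "card (S - P) = 1"
            using r4 by (simp add: card_Diff_subset)
          then obtain w where "S - P = {w}"
            by (auto simp: card_1_singleton_iff)
          then have "S = insert w P" "w \<notin> P" "w \<in> V"
            using S' by auto
          then show "S \<in> (\<lambda>w. insert w P) ` completions F P"
            using S by (auto simp: completions_def)
        qed
      qed (auto simp: completions_def)
    qed
  qed
  then have "(\<Sum>P\<in>nsets V (r - 2). card (completions F P)) = (\<Sum>P\<in>nsets V (r - 2). card {S \<in> F. P \<subseteq> S})"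
    by (intro sum.cong) auto
  also have "\<dots> = card F * ((r - 1) choose (r - 2))"
    by (rule sum_card_supersets[OF finV assms])
  also have "(r - 1) choose (r - 2) = r - 1"
  proof -
    have "r - 1 = Suc (r - 2)"
      using r4 by simp
    then show ?thesis
      by (metis binomial_Suc_n)
  qed
  finally show ?thesis by simp
qed

lemma card_star_inter_le:
  assumes "v \<in> W" "v' \<in> W" "v \<noteq> v'"
  shows "card (star W v \<inter> star W v') \<le> (r - 1) * card V ^ (r - 2)"
proof (cases "star W v \<inter> star W v' = {}")
  case False
  then obtain S0 where S0: "S0 \<in> star W v" "S0 \<in> star W v'"
    by blast
  have ne: "S \<noteq> {}" if "S \<in> star W v" for S
    using that r4 by (auto simp: star_def nsets_def)
  have "star W v \<inter> star W v' \<subseteq> {S \<in> nsets V (r - 1). S \<inter> S0 \<noteq> {}}"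
  proof
    fix S assume S: "S \<in> star W v \<inter> star W v'"
    have "S \<inter> S0 \<noteq> {}"
      using common_link_intersecting[of "{v}" "{v'}" S S0] S S0 ne assms star_linkD by auto
    then show "S \<in> {S \<in> nsets V (r - 1). S \<inter> S0 \<noteq> {}}"
      using S by (auto simp: star_def)
  qed
  then have "card (star W v \<inter> star W v') \<le> card {S \<in> nsets V (r - 1). S \<inter> S0 \<noteq> {}}"
    using finite_nsets_V by (intro card_mono) auto
  also have "\<dots> \<le> card S0 * card V ^ (r - 1 - 1)"
    using S0 finV r4 by (intro card_nsets_meeting) (auto simp: star_def nsets_def)
  also have "card S0 = r - 1"
    using S0 by (auto simp: star_def nsets_def)
  finally show ?thesis
    by (simp add: numeral_2_eq_2)
qed auto

text \<open>An edge that meets \<open>W\<close> in the single vertex \<open>v\<close> is determined by the rest \<open>S\<close> of it unless \<open>S\<close> also lies in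
  another star, and two stars have few common members.\<close>

lemma card_edges_meeting_le:
  assumes W: "W \<subseteq> V"
  shows "card {A \<in> E. A \<inter> W \<noteq> {}} \<le> card (stars W) + r * (card W) ^ 2 * card V ^ (r - 2)"
proof -
  let ?M = "{A \<in> E. A \<inter> W \<noteq> {}}"
  let ?two = "(\<lambda>((v, v'), R). insert v (insert v' R)) ` ((W \<times> W) \<times> nsets V (r - 2))"
  let ?I = "{(v, v') \<in> W \<times> W. v \<noteq> v'}"
  let ?over = "\<Union>p\<in>?I. insert (fst p) ` (star W (fst p) \<inter> star W (snd p))"
  have finW: "finite W"
    using W finV finite_subset by blast
  have finI: "finite ?I"
    by (rule finite_subset[of _ "W \<times> W"]) (auto simp: finW)
  \<comment> \<open>\<open>f S\<close> is a preferred centre of \<open>S\<close>; every other centre of \<open>S\<close> is charged to \<open>?over\<close>.\<close>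
  define f where "f S = (SOME v. v \<in> W \<and> S \<in> star W v)" for S
  have f: "f S \<in> W \<and> S \<in> star W (f S)" if "S \<in> stars W" for S
  proof -
    have "\<exists>v. v \<in> W \<and> S \<in> star W v"
      using that by (auto simp: stars_def)
    then show ?thesis
      unfolding f_def by (rule someI_ex)
  qed
  have "?M \<subseteq> ?two \<union> (\<lambda>S. insert (f S) S) ` stars W \<union> ?over"
  proof
    fix A assume "A \<in> ?M"
    then obtain v where A: "A \<in> E" "A \<subseteq> V" "finite A" "card A = r" and v: "v \<in> A" "v \<in> W"
      using edgeD by blast
    show "A \<in> ?two \<union> (\<lambda>S. insert (f S) S) ` stars W \<union> ?over"
    proof (cases "(A - {v}) \<inter> W = {}")
      case True
      obtain S where Ains: "A = insert v S" and vS: "v \<notin> S"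
        using v(1) by (metis mk_disjoint_insert)
      have S: "S \<in> star W v"
        using A v True vS unfolding star_def nsets_def Ains by auto
      then have S': "S \<in> stars W"
        using v by (auto simp: stars_def)
      show ?thesis
      proof (cases "f S = v")
        case True
        then have "A = insert (f S) S"
          using Ains by simp
        then show ?thesis
          using S' by blast
      next
        case False
        then have "(v, f S) \<in> ?I" "S \<in> star W v \<inter> star W (f S)"
          using v f[OF S'] S by auto
        then have "A \<in> ?over"
          unfolding Ains by force
        then show ?thesis by blast
      qed
    next
      case False
      then obtain v' where v': "v' \<in> A" "v' \<noteq> v" "v' \<in> W"
        by blast
      have "A - {v, v'} \<in> nsets V (r - 2)"
        using A v v' by (auto simp: nsets_def card_Diff_subset)
      moreover have "A = insert v (insert v' (A - {v, v'}))"
        using v v' by auto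
      ultimately have "A \<in> ?two"
        using v v' by (intro image_eqI[of _ _ "((v, v'), A - {v, v'})"]) auto
      then show ?thesis by blast
    qed
  qed
  then have "card ?M \<le> card (?two \<union> (\<lambda>S. insert (f S) S) ` stars W \<union> ?over)"
    using finW finI finite_nsets_V finite_stars finite_star by (intro card_mono) auto
  also have "\<dots> \<le> card ?two + card ((\<lambda>S. insert (f S) S) ` stars W) + card ?over"
    by (meson add_mono card_Un_le le_refl order_trans)
  also have "\<dots> \<le> (card W)\<^sup>2 * card V ^ (r - 2) + card (stars W) + (card W)\<^sup>2 * ((r - 1) * card V ^ (r - 2))"
  proof (intro add_mono)
    have "card ?two \<le> card ((W \<times> W) \<times> nsets V (r - 2))"
      using finW finite_nsets_V by (intro card_image_le) auto
    also have "\<dots> \<le> (card W)\<^sup>2 * card V ^ (r - 2)"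
      using card_nsets_le_power[OF finV, of "r - 2"]
      unfolding card_cartesian_product power2_eq_square by (intro mult_left_mono) auto
    finally show "card ?two \<le> (card W)\<^sup>2 * card V ^ (r - 2)" .
    show "card ((\<lambda>S. insert (f S) S) ` stars W) \<le> card (stars W)"
      by (rule card_image_le[OF finite_stars])
    have "card ?over \<le> (\<Sum>p\<in>?I. card (insert (fst p) ` (star W (fst p) \<inter> star W (snd p))))"
      by (rule card_UN_le[OF finI])
    also have "\<dots> \<le> (\<Sum>p\<in>?I. card (star W (fst p) \<inter> star W (snd p)))"
      by (intro sum_mono card_image_le) (auto simp: finite_star)
    also have "\<dots> \<le> (\<Sum>p\<in>?I. (r - 1) * card V ^ (r - 2))"
      by (intro sum_mono card_star_inter_le) auto
    also have "\<dots> = card ?I * ((r - 1) * card V ^ (r - 2))"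
      by simp
    also have "\<dots> \<le> card (W \<times> W) * ((r - 1) * card V ^ (r - 2))"
      using finW by (intro mult_right_mono card_mono) auto
    finally show "card ?over \<le> (card W)\<^sup>2 * ((r - 1) * card V ^ (r - 2))"
      by (simp add: card_cartesian_product power2_eq_square)
  qed
  also have "\<dots> = card (stars W) + r * (card W)\<^sup>2 * card V ^ (r - 2)"
  proof -
    obtain s where "r = Suc s"
      using r4 by (cases r) auto
    then show ?thesis
      by (simp add: algebra_simps)
  qed
  finally show ?thesis .
qed

section \<open>The edges of small codegree compete with the stars\<close>

text \<open>If \<open>w\<close> completes both \<open>P1\<close> and \<open>P2\<close> to members of the star of \<open>v\<close>, then \<open>{v, w}\<close> belongs to the common
  link of \<open>P1\<close> and \<open>P2\<close>, just as \<open>Q\<close> does.  Since \<open>Q\<close> avoids \<open>v\<close>, the two can only meet in \<open>w\<close>.\<close>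

lemma common_completions_subset:
  assumes v: "v \<in> W" and P: "P1 \<inter> P2 = {}" and Q: "P1 \<in> link E Q" "P2 \<in> link E Q" "Q \<inter> W = {}" "card Q = 2"
  shows "completions (star W v) P1 \<inter> completions (star W v) P2 \<subseteq> Q"
proof
  fix w assume w: "w \<in> completions (star W v) P1 \<inter> completions (star W v) P2"
  have ne: "P1 \<noteq> {}" "P2 \<noteq> {}"
    using Q linkD(7) r4 by fastforce+
  have L: "{v, w} \<in> link E P" if "w \<in> completions (star W v) P" for P
    using that v by (auto simp: completions_def star_def link_def insert_commute)
  have "Q \<inter> {v, w} \<noteq> {}"
    using common_link_intersecting[OF P ne, of Q "{v, w}"] L w Q link_commute by fastforce
  then show "w \<in> Q"
    using v Q(3) by auto
qed

text \<open>For a fixed pair \<open>Q\<close>, the link of \<open>Q\<close> in \<open>E'\<close> consists mostly of disjoint sets, whose completion sets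
  overlap in at most two vertices by \<open>common_completions_subset\<close>.  A large number of almost disjoint subsets of
  \<open>V\<close> must be small on average, so the sum is much smaller than its trivial bound of order \<open>n^r\<close>.\<close>

lemma sum_star_completions_le:
  fixes c \<eta> :: real
  assumes W: "v \<in> W" and E': "E' \<subseteq> E" and avoid: "\<And>A. A \<in> E' \<Longrightarrow> A \<inter> W = {}"
    and thin: "\<And>T. card T = 3 \<Longrightarrow> real (card {A \<in> E'. T \<subseteq> A}) \<le> c * real (card V) ^ (r - 3)"
    and c: "c \<ge> 0" and E'_le: "real (card E') \<le> real (card V) ^ (r - 1)"
    and \<eta>: "\<eta> \<ge> 0" "2 * real r ^ 3 * c \<le> \<eta>\<^sup>2"
  shows "(\<Sum>Q\<in>nsets V 2. \<Sum>P\<in>link E' Q. real (card (completions (star W v) P))) \<le> \<eta> * real (card V) ^ r"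
proof -
  interpret E': c4_free_graph r V E'
    by (rule subgraph[OF E'])
  let ?n = "real (card V)" and ?N2 = "nsets V 2"
  let ?D = "c * ?n ^ (r - 3)"
  define M where "M = completions (star W v)"
  define x where "x Q = (\<Sum>P\<in>link E' Q. real (card (M P)))" for Q
  define l where "l Q = real (card (link E' Q))" for Q
  define J where "J Q = real (card (E'.crossing_pairs Q))" for Q
  have D0: "?D \<ge> 0"
    using c by simp
  have M_le: "real (card (M P)) \<le> ?n" for P
    unfolding M_def using card_completions_le by simp
  \<comment> \<open>The terms with \<open>P1 = P2\<close> and other crossing pairs are paid for by \<open>J\<close>; the remaining ones contribute \<open>2 (l Q)\<^sup>2\<close>,
      which is small because \<open>l Q\<close> itself is at most \<open>c n^(r-2)\<close>.\<close>
  have l_le: "l Q \<le> ?n * ?D" if Q: "Q \<in> ?N2" for Q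
  proof -
    have "link E' Q \<subseteq> (\<Union>y\<in>V - Q. {P \<in> link E' Q. y \<in> P})"
    proof
      fix P assume P: "P \<in> link E' Q"
      have "P \<noteq> {}"
        using E'.linkD(7)[OF P] Q r4 by (auto simp: nsets_def)
      then obtain y where "y \<in> P"
        by blast
      with E'.linkD(1,6)[OF P] P show "P \<in> (\<Union>y\<in>V - Q. {P \<in> link E' Q. y \<in> P})"
        by auto
    qed
    then have "card (link E' Q) \<le> card (\<Union>y\<in>V - Q. {P \<in> link E' Q. y \<in> P})"
      using finV E'.finite_link by (intro card_mono) auto
    also have "\<dots> \<le> (\<Sum>y\<in>V - Q. card {P \<in> link E' Q. y \<in> P})"
      using finV by (intro card_UN_le) auto
    finally have "l Q \<le> (\<Sum>y\<in>V - Q. real (card {P \<in> link E' Q. y \<in> P}))"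
      unfolding l_def by (simp only: of_nat_le_iff flip: of_nat_sum)
    also have "\<dots> \<le> (\<Sum>y\<in>V - Q. ?D)"
      using Q by (intro sum_mono E'.card_link_through_le thin) (auto simp: nsets_def)
    also have "\<dots> = real (card (V - Q)) * ?D"
      by simp
    also have "\<dots> \<le> ?n * ?D"
      using finV D0 by (intro mult_right_mono of_nat_mono card_mono) auto
    finally show ?thesis .
  qed
  have x_sq: "(x Q)\<^sup>2 \<le> ?n * (2 * (l Q)\<^sup>2 + ?n * J Q)" if Q: "Q \<in> ?N2" for Q
  proof -
    have "(x Q)\<^sup>2 \<le> ?n * (\<Sum>P1\<in>link E' Q. \<Sum>P2\<in>link E' Q. real (card (M P1 \<inter> M P2)))"
      unfolding x_def
      by (rule sum_card_squared_le[OF E'.finite_link finV]) (auto simp: M_def completions_def)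
    also have "\<dots> \<le> ?n * (2 * (l Q)\<^sup>2 + ?n * J Q)"
    proof (rule mult_left_mono)
      have "(\<Sum>P1\<in>link E' Q. \<Sum>P2\<in>link E' Q. real (card (M P1 \<inter> M P2)))
          = (\<Sum>p\<in>link E' Q \<times> link E' Q. real (card (M (fst p) \<inter> M (snd p))))"
        by (simp add: sum.cartesian_product split_beta)
      also have "\<dots> \<le> (\<Sum>p\<in>link E' Q \<times> link E' Q. 2 + (if p \<in> E'.crossing_pairs Q then ?n else 0))"
      proof (rule sum_mono)
        fix p assume p: "p \<in> link E' Q \<times> link E' Q"
        obtain P1 P2 where P: "p = (P1, P2)" "P1 \<in> link E' Q" "P2 \<in> link E' Q"
          using p by auto
        show "real (card (M (fst p) \<inter> M (snd p))) \<le> 2 + (if p \<in> E'.crossing_pairs Q then ?n else 0)"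
        proof (cases "P1 \<inter> P2 = {}")
          case True
          have "Q \<union> P1 \<in> E'"
            using P(2) by (simp add: link_def)
          then have "Q \<inter> W = {}"
            using avoid by blast
          then have "M P1 \<inter> M P2 \<subseteq> Q"
            unfolding M_def using W True P Q link_mono[OF E']
            by (intro common_completions_subset) (auto simp: nsets_def)
          then have "card (M P1 \<inter> M P2) \<le> card Q"
            using Q by (intro card_mono) (auto simp: nsets_def)
          then show ?thesis
            using Q P by (auto simp: nsets_def)
        next
          case False
          then have "p \<in> E'.crossing_pairs Q"
            using P by (auto simp: E'.crossing_pairs_def)
          moreover have "card (M P1 \<inter> M P2) \<le> card (M P1)"
            unfolding M_def using finite_completions by (intro card_mono) auto
          ultimately show ?thesis
            using M_le[of P1] P by simp
        qed
      qed
      also have "\<dots> = 2 * (l Q)\<^sup>2 + (\<Sum>p\<in>link E' Q \<times> link E' Q. if p \<in> E'.crossing_pairs Q then ?n else 0)"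
        by (simp add: sum.distrib l_def card_cartesian_product power2_eq_square)
      also have "(\<Sum>p\<in>link E' Q \<times> link E' Q. if p \<in> E'.crossing_pairs Q then ?n else 0)
          = (\<Sum>p\<in>(link E' Q \<times> link E' Q) \<inter> E'.crossing_pairs Q. ?n)"
        using E'.finite_link by (subst sum.inter_restrict) auto
      also have "(link E' Q \<times> link E' Q) \<inter> E'.crossing_pairs Q = E'.crossing_pairs Q"
        by (auto simp: E'.crossing_pairs_def)
      finally show "(\<Sum>P1\<in>link E' Q. \<Sum>P2\<in>link E' Q. real (card (M P1 \<inter> M P2))) \<le> 2 * (l Q)\<^sup>2 + ?n * J Q"
        by (simp add: J_def mult.commute)
    qed simp
    finally show ?thesis .
  qed
  have sum_l: "(\<Sum>Q\<in>?N2. l Q) \<le> real r ^ 2 * real (card E')"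
  proof -
    have "(\<Sum>Q\<in>?N2. l Q) = real (\<Sum>Q\<in>?N2. card (link E' Q))"
      by (simp add: l_def)
    also have "\<dots> = real (card E') * real (r choose 2)"
      by (simp add: E'.sum_card_link)
    also have "\<dots> \<le> real (card E') * real (r ^ 2)"
      using binomial_fact_pow[of r 2] by (intro mult_left_mono of_nat_mono) (auto simp: fact_2)
    finally show ?thesis
      by (simp add: mult.commute)
  qed
  have sum_J: "(\<Sum>Q\<in>?N2. J Q) \<le> real (card E') * (real r ^ 3 * ?D)"
    unfolding J_def by (intro E'.sum_crossing_pairs_le thin D0)
  have "(\<Sum>Q\<in>?N2. x Q)\<^sup>2 \<le> (\<Sum>Q\<in>?N2. (x Q)\<^sup>2) * real (card ?N2)"
    by (rule sum_squared_le_sum_of_squares)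
  also have "\<dots> \<le> (\<Sum>Q\<in>?N2. ?n * (2 * (l Q)\<^sup>2 + ?n * J Q)) * ?n ^ 2"
  proof (rule mult_mono)
    have "card ?N2 \<le> card V ^ 2"
      by (rule card_nsets_le_power[OF finV])
    then show "real (card ?N2) \<le> ?n ^ 2"
      by (metis of_nat_le_iff of_nat_power)
    show "(\<Sum>Q\<in>?N2. (x Q)\<^sup>2) \<le> (\<Sum>Q\<in>?N2. ?n * (2 * (l Q)\<^sup>2 + ?n * J Q))"
      by (intro sum_mono x_sq)
  qed (auto intro!: sum_nonneg mult_nonneg_nonneg add_nonneg_nonneg simp: J_def)
  also have "(\<Sum>Q\<in>?N2. ?n * (2 * (l Q)\<^sup>2 + ?n * J Q)) = ?n * (2 * (\<Sum>Q\<in>?N2. (l Q)\<^sup>2) + ?n * (\<Sum>Q\<in>?N2. J Q))"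
    by (simp add: sum_distrib_left sum.distrib algebra_simps)
  also have "\<dots> \<le> ?n * (2 * (?n * ?D * (real r ^ 2 * real (card E'))) + ?n * (real (card E') * (real r ^ 3 * ?D)))"
  proof (intro mult_left_mono add_mono sum_J)
    have "(\<Sum>Q\<in>?N2. (l Q)\<^sup>2) \<le> (\<Sum>Q\<in>?N2. (?n * ?D) * l Q)"
      unfolding power2_eq_square by (intro sum_mono mult_right_mono l_le) (auto simp: l_def)
    also have "\<dots> = (?n * ?D) * (\<Sum>Q\<in>?N2. l Q)"
      by (simp add: sum_distrib_left)
    also have "\<dots> \<le> (?n * ?D) * (real r ^ 2 * real (card E'))"
      using D0 sum_l by (intro mult_left_mono) auto
    finally show "(\<Sum>Q\<in>?N2. (l Q)\<^sup>2) \<le> ?n * ?D * (real r ^ 2 * real (card E'))" .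
  qed auto
  also have "?n * (2 * (?n * ?D * (real r ^ 2 * real (card E'))) + ?n * (real (card E') * (real r ^ 3 * ?D)))
      = (?n ^ 2 * ?D * (2 * real r ^ 2 + real r ^ 3)) * real (card E')"
    by (simp add: power2_eq_square algebra_simps)
  also have "\<dots> \<le> (?n ^ 2 * ?D * (2 * real r ^ 3)) * ?n ^ (r - 1)"
  proof (rule mult_mono[OF _ E'_le])
    have "2 * real r ^ 2 \<le> real r * real r ^ 2"
      using r4 by (intro mult_right_mono) auto
    then have "2 * real r ^ 2 + real r ^ 3 \<le> 2 * real r ^ 3"
      by (simp add: power2_eq_square power3_eq_cube)
    then show "?n ^ 2 * ?D * (2 * real r ^ 2 + real r ^ 3) \<le> ?n ^ 2 * ?D * (2 * real r ^ 3)"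
      using D0 by (intro mult_left_mono) auto
  qed (use D0 in auto)
  also have "(?n ^ 2 * ?D * (2 * real r ^ 3)) * ?n ^ (r - 1) * ?n ^ 2
      = (2 * real r ^ 3 * c) * (?n ^ 2 * ?n ^ (r - 3) * ?n ^ (r - 1) * ?n ^ 2)"
    by (simp add: algebra_simps)
  also have "?n ^ 2 * ?n ^ (r - 3) * ?n ^ (r - 1) * ?n ^ 2 = (?n ^ r)\<^sup>2"
  proof -
    have "2 + (r - 3) + (r - 1) + 2 = r * 2"
      using r4 by simp
    then show ?thesis
      by (metis power_add power_mult)
  qed
  finally have "(\<Sum>Q\<in>?N2. x Q)\<^sup>2 \<le> (2 * real r ^ 3 * c) * (?n ^ r)\<^sup>2"
    by (simp add: mult_right_mono)
  also have "\<dots> \<le> \<eta>\<^sup>2 * (?n ^ r)\<^sup>2"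
    using \<eta> by (intro mult_right_mono) auto
  also have "\<dots> = (\<eta> * ?n ^ r)\<^sup>2"
    by (simp add: power_mult_distrib)
  finally have "(\<Sum>Q\<in>?N2. x Q) \<le> \<eta> * ?n ^ r"
    by (rule power2_le_imp_le) (use \<eta> in auto)
  then show ?thesis
    by (simp add: x_def M_def)
qed

text \<open>The count \<open>weighted_link_count\<close> is applied with \<open>u P\<close> the proportion of vertices that do not complete \<open>P\<close> to
  a member of the stars.  By \<open>sum_star_completions_le\<close> this hardly changes the left-hand side of the count,
  while the total weight \<open>Y\<close> of all \<open>P\<close> decreases in proportion to the number of sets that the stars
  do not contain.\<close>

lemma thin_part_le:
  fixes c \<eta> :: real
  assumes W: "W \<subseteq> V" and E': "E' \<subseteq> E" and avoid: "\<And>A. A \<in> E' \<Longrightarrow> A \<inter> W = {}"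
    and thin: "\<And>T. card T = 3 \<Longrightarrow> real (card {A \<in> E'. T \<subseteq> A}) \<le> c * real (card V) ^ (r - 3)"
    and ctr: "\<And>x y S. x \<noteq> y \<Longrightarrow> S \<in> link E' {x} \<Longrightarrow> S \<in> link E' {y} \<Longrightarrow> ctr x y \<in> S"
    and c: "c \<ge> 0" and E'_le: "real (card E') \<le> real (card V) ^ (r - 1)"
    and \<eta>: "\<eta> \<ge> 0" "2 * real r ^ 3 * c \<le> \<eta>\<^sup>2" and "V \<noteq> {}"
  shows "real (card E') \<le> 5 / 8 * (real (card V) ^ (r - 1) / fact (r - 1) - real (card (stars W)))
    + (real (card W) + 2) * \<eta> * real (card V) ^ (r - 1)"
proof -
  interpret E': c4_free_graph r V E'
    by (rule subgraph[OF E'])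
  let ?n = "real (card V)" and ?N2 = "nsets V 2" and ?N = "nsets V (r - 2)"
  let ?b = "real (card (stars W))" and ?h = "real (card E')"
  have n: "?n > 0"
    using finV \<open>V \<noteq> {}\<close> by (simp add: card_gt_0_iff)
  have finW: "finite W"
    using W finV finite_subset by blast
  define M where "M P = real (card (completions (stars W) P))" for P
  define u where "u P = 1 - M P / ?n" for P
  define s where "s = \<eta> * ?n ^ (r - 2)"
  define X where "X = (\<Sum>Q\<in>?N2. \<Sum>P\<in>link E' Q. u P)"
  define Y where "Y = (\<Sum>P\<in>?N. u P)"
  have M: "0 \<le> M P" "M P \<le> ?n" for P
    using card_completions_le by (auto simp: M_def)
  have u: "0 \<le> u P" "u P \<le> 1" for P
    using M[of P] n by (auto simp: u_def field_simps)
  have s0: "s \<ge> 0"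
    using \<eta> by (simp add: s_def)
  have Y0: "Y \<ge> 0"
    unfolding Y_def using u by (intro sum_nonneg) auto
  have pow: "?n * ?n ^ (r - 2) = ?n ^ (r - 1)" "?n * ?n ^ (r - 1) = ?n ^ r"
  proof -
    have "Suc (r - 2) = r - 1" "Suc (r - 1) = r"
      using r4 by auto
    then show "?n * ?n ^ (r - 2) = ?n ^ (r - 1)" "?n * ?n ^ (r - 1) = ?n ^ r"
      by (metis power_Suc)+
  qed
  have cross: "(\<Sum>Q\<in>?N2. real (card (E'.crossing_pairs Q))) \<le> s\<^sup>2"
  proof -
    have "(\<Sum>Q\<in>?N2. real (card (E'.crossing_pairs Q))) \<le> ?h * (real r ^ 3 * (c * ?n ^ (r - 3)))"
      using c by (intro E'.sum_crossing_pairs_le thin) auto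
    also have "\<dots> \<le> ?n ^ (r - 1) * (real r ^ 3 * (c * ?n ^ (r - 3)))"
      using c E'_le by (intro mult_right_mono) auto
    also have "\<dots> = (real r ^ 3 * c) * (?n ^ (r - 1) * ?n ^ (r - 3))"
      by simp
    also have "?n ^ (r - 1) * ?n ^ (r - 3) = (?n ^ (r - 2))\<^sup>2"
    proof -
      have "(r - 1) + (r - 3) = (r - 2) * 2"
        using r4 by simp
      then show ?thesis
        by (metis power_add power_mult)
    qed
    also have "(real r ^ 3 * c) * (?n ^ (r - 2))\<^sup>2 \<le> \<eta>\<^sup>2 * (?n ^ (r - 2))\<^sup>2"
    proof (rule mult_right_mono)
      have "real r ^ 3 * c \<ge> 0"
        using c by simp
      then show "real r ^ 3 * c \<le> \<eta>\<^sup>2"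
        using \<eta>(2) by linarith
    qed simp
    finally show ?thesis
      by (simp add: s_def power_mult_distrib)
  qed
  \<comment> \<open>Rounding \<open>3/2\<close> up to the square \<open>25/16\<close> keeps the constant rational.\<close>
  have "X\<^sup>2 \<le> 3 / 2 * ?n ^ 2 * (Y\<^sup>2 + (\<Sum>Q\<in>?N2. real (card (E'.crossing_pairs Q))))"
    unfolding X_def Y_def using u ctr by (rule E'.weighted_link_count)
  also have "\<dots> \<le> 3 / 2 * ?n ^ 2 * (Y\<^sup>2 + s\<^sup>2)"
    using cross by (intro mult_left_mono) auto
  also have "\<dots> \<le> (25 / 16) * ?n ^ 2 * (Y + s)\<^sup>2"
  proof (intro mult_mono)
    show "Y\<^sup>2 + s\<^sup>2 \<le> (Y + s)\<^sup>2"
      using Y0 s0 by (simp add: power2_sum)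
  qed auto
  also have "\<dots> = (5 / 4 * (?n * (Y + s)))\<^sup>2"
    by (simp add: power_mult_distrib power_divide)
  finally have XY: "X \<le> 5 / 4 * (?n * (Y + s))"
    by (rule power2_le_imp_le) (use Y0 s0 in auto)
  have Y: "?n * Y \<le> real (r - 1) * (?n ^ (r - 1) / fact (r - 1) - ?b)"
  proof -
    have "Y = real (card ?N) - (\<Sum>P\<in>?N. M P) / ?n"
      by (simp add: Y_def u_def sum_subtractf sum_divide_distrib)
    also have "(\<Sum>P\<in>?N. M P) = real (r - 1) * ?b"
      using arg_cong[OF sum_card_completions[OF stars_subset], of real] by (simp add: M_def)
    finally have Yeq: "Y = real (card V choose (r - 2)) - real (r - 1) * ?b / ?n"
      using finV by simp
    have "?n * Y = ?n * real (card V choose (r - 2)) - real (r - 1) * ?b"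
      unfolding Yeq right_diff_distrib using n by simp
    also have "real (card V choose (r - 2)) \<le> ?n ^ (r - 2) / fact (r - 2)"
      using of_nat_mono[OF binomial_fact_pow[of "card V" "r - 2"], where 'a = real]
      by (simp add: field_simps)
    also have "?n * (?n ^ (r - 2) / fact (r - 2)) = real (r - 1) * (?n ^ (r - 1) / fact (r - 1))"
    proof -
      have "fact (r - 1) = real (r - 1) * fact (r - 2)"
      proof -
        have "r - 1 = Suc (r - 2)"
          using r4 by simp
        then show ?thesis
          by (metis fact_Suc of_nat_Suc of_nat_fact of_nat_mult)
      qed
      moreover have "m * (x / (m * y)) = x / y" if "m \<noteq> 0" for m x y :: real
        using that by simp
      moreover have "real (r - 1) \<noteq> 0"
        using r4 by simp
      ultimately show ?thesis
        using pow(1) by (metis times_divide_eq_right)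
    qed
    finally show ?thesis
      using n by (simp add: right_diff_distrib)
  qed
  have X: "real (r choose 2) * ?h - real (card W) * \<eta> * ?n ^ (r - 1) \<le> X"
  proof -
    have "(\<Sum>Q\<in>?N2. \<Sum>P\<in>link E' Q. M P)
        \<le> (\<Sum>Q\<in>?N2. \<Sum>P\<in>link E' Q. \<Sum>v\<in>W. real (card (completions (star W v) P)))"
      unfolding M_def using card_completions_stars_le[OF finW]
      by (intro sum_mono) (simp only: of_nat_le_iff flip: of_nat_sum)
    also have "\<dots> = (\<Sum>Q\<in>?N2. \<Sum>v\<in>W. \<Sum>P\<in>link E' Q. real (card (completions (star W v) P)))"
      by (intro sum.cong refl sum.swap)
    also have "\<dots> = (\<Sum>v\<in>W. \<Sum>Q\<in>?N2. \<Sum>P\<in>link E' Q. real (card (completions (star W v) P)))"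
      by (rule sum.swap)
    also have "\<dots> \<le> (\<Sum>v\<in>W. \<eta> * ?n ^ r)"
      by (intro sum_mono sum_star_completions_le[where c = c] E' avoid thin c E'_le \<eta>)
    also have "\<dots> = real (card W) * \<eta> * ?n ^ (r - 1) * ?n"
      using pow(2) by (simp add: mult.commute)
    finally have "(\<Sum>Q\<in>?N2. \<Sum>P\<in>link E' Q. M P) / ?n \<le> real (card W) * \<eta> * ?n ^ (r - 1)"
      using n by (simp add: field_simps)
    moreover have "X = real (\<Sum>Q\<in>?N2. card (link E' Q)) - (\<Sum>Q\<in>?N2. \<Sum>P\<in>link E' Q. M P) / ?n"
      by (simp add: X_def u_def sum_subtractf sum_divide_distrib)
    ultimately show ?thesis
      by (simp add: E'.sum_card_link mult.commute)
  qed
  let ?L = "?n ^ (r - 1) / fact (r - 1)" and ?B = "?n ^ (r - 1)"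
  have "2 * real (r - 1) * ?h \<le> real (r choose 2) * ?h"
  proof (rule mult_right_mono)
    have "2 * (2 * (r - 1)) \<le> r * (r - 1)"
      using r4 mult_le_mono1[of 4 r "r - 1"] by simp
    then have "2 * (r - 1) \<le> (r choose 2)"
      unfolding choose_two by linarith
    then show "2 * real (r - 1) \<le> real (r choose 2)"
      by (metis of_nat_le_iff of_nat_mult of_nat_numeral)
  qed simp
  also have "\<dots> \<le> 5 / 4 * (real (r - 1) * (?L - ?b)) + (real (card W) + 2) * \<eta> * ?B"
  proof -
    have "?n * s = \<eta> * ?B"
      using pow by (simp add: s_def algebra_simps)
    then have 1: "5 / 4 * (?n * (Y + s)) = 5 / 4 * (?n * Y) + 5 / 4 * (\<eta> * ?B)"
      by (simp add: algebra_simps)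
    have 2: "5 / 4 * (\<eta> * ?B) \<le> 2 * (\<eta> * ?B)"
      using \<eta> by (intro mult_right_mono) auto
    have 3: "(real (card W) + 2) * \<eta> * ?B = real (card W) * \<eta> * ?B + 2 * (\<eta> * ?B)"
      by (simp add: algebra_simps)
    have "C \<le> 5 / 4 * Z + T'" if "C - t \<le> x" "x \<le> x'" "x' = 5 / 4 * y + 5 / 4 * q" "y \<le> Z"
      "5 / 4 * q \<le> 2 * q" "T' = t + 2 * q" for C Z T' t x x' y q :: real
      using that by linarith
    from this[OF X XY 1 Y 2 3] show ?thesis .
  qed
  also have "\<dots> \<le> 5 / 4 * (real (r - 1) * (?L - ?b)) + 2 * real (r - 1) * ((real (card W) + 2) * \<eta> * ?B)"
  proof -
    have "1 * ((real (card W) + 2) * \<eta> * ?B) \<le> 2 * real (r - 1) * ((real (card W) + 2) * \<eta> * ?B)"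
      using \<eta> r4 by (intro mult_right_mono) (auto simp: of_nat_diff)
    then show ?thesis by simp
  qed
  finally have "2 * real (r - 1) * ?h \<le> 2 * real (r - 1) * (5 / 8 * (?L - ?b) + (real (card W) + 2) * \<eta> * ?B)"
    by (simp add: algebra_simps)
  moreover have "2 * real (r - 1) > 0"
    using r4 by simp
  ultimately show ?thesis
    using mult_le_cancel_left_pos by blast
qed

section \<open>One star dominates\<close>

text \<open>Otherwise the disjoint \<open>(r-1)\<close>-sets \<open>insert v P1\<close> and \<open>insert v' P2\<close> would have two common extensions.\<close>

lemma card_completions_inter_le_1:
  assumes "v \<in> W" "v' \<in> W" "v \<noteq> v'" and P: "P1 \<in> nsets V (r - 2)" "P2 \<in> nsets V (r - 2)" "P1 \<inter> P2 = {}"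
  shows "card (completions (star W v) P1 \<inter> completions (star W v') P2) \<le> 1"
proof (cases "completions (star W v) P1 \<inter> completions (star W v') P2 = {}")
  case False
  let ?C = "completions (star W v) P1 \<inter> completions (star W v') P2"
  have W: "P1 \<inter> W = {}" "P2 \<inter> W = {}"
    using False by (auto simp: completions_def star_def)
  have "card (insert v P1) = r - 1" "card (insert v' P2) = r - 1"
    using P W assms(1,2) r4 by (auto simp: nsets_def card_insert_if)
  then have le1: "card (link E (insert v P1) \<inter> link E (insert v' P2)) \<le> 1"
    using W assms by (intro card_common_extensions_le_1) auto
  have "(\<lambda>w. {w}) ` ?C \<subseteq> link E (insert v P1) \<inter> link E (insert v' P2)"
    using assms(1,2) by (auto simp: completions_def star_def link_def insert_commute)
  then have "card ((\<lambda>w. {w}) ` ?C) \<le> 1"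
    using le1 finite_link card_mono by (metis (no_types, lifting) finite_Int order_trans)
  moreover have "card ((\<lambda>w. {w}) ` ?C) = card ?C"
    by (intro card_image inj_onI) auto
  ultimately show ?thesis
    by simp
qed auto

text \<open>Fix an \<open>(r-2)\<close>-set \<open>Q\<close> that almost every vertex completes to a member of a star, and colour the vertex \<open>w\<close> by
  the centre \<open>v\<close> of this star (\<open>X v\<close> is a colour class).  By \<open>card_completions_inter_le_1\<close>, for every \<open>P\<close> disjoint
  from \<open>Q\<close> only boundedly many \<open>w\<close> complete \<open>P\<close> to a member of a star whose centre is not a colour of \<open>w\<close>.  So,
  apart from few exceptions, a member of the star of \<open>v\<close> consists of vertices of colour \<open>v\<close> only; in other
  words, almost all \<open>(r-1)\<close>-sets are monochromatic.  As the sum of the \<open>(r-1)\<close>-st powers of the class sizes is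
  then almost \<open>n^(r-1)\<close>, one class contains almost all vertices, and its star contains almost all sets.\<close>

lemma dominant_star:
  fixes e :: real
  assumes W: "W \<subseteq> V" and V: "V \<noteq> {}"
    and b: "real (card V) ^ (r - 1) / fact (r - 1) - e * real (card V) ^ (r - 1) \<le> real (card (stars W))"
    and cardW: "real ((card W)\<^sup>2) \<le> e * real (card V)"
    and e: "e \<ge> 0" "e * fact (r - 1) < 1"
  shows "\<exists>v\<in>W. real (card V) ^ (r - 1) / fact (r - 1) - 5 * (fact (r - 1))\<^sup>2 * e * real (card V) ^ (r - 1)
    \<le> real (card (star W v))"
proof -
  let ?n = "real (card V)" and ?f = "fact (r - 1) :: real" and ?N = "nsets V (r - 2)"
  let ?B = "?n ^ (r - 1)"
  define R where "R = ?n ^ (r - 2)"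
  have n: "?n > 0"
    using finV V by (simp add: card_gt_0_iff)
  have R: "R > 0"
    using n by (simp add: R_def)
  have r1: "r - 1 = Suc (r - 2)"
    using r4 by simp
  have B: "?B = ?n * R"
    by (simp only: R_def r1 power_Suc)
  have finW: "finite W"
    using W finV finite_subset by blast
  have f: "?f = real (r - 1) * fact (r - 2)"
    by (metis r1 fact_Suc of_nat_Suc of_nat_fact of_nat_mult)
  have f6: "?f \<ge> 2"
  proof -
    have "fact 2 \<le> (fact (r - 1) :: real)"
      using r4 by (intro fact_mono) auto
    then show ?thesis by (simp add: fact_2)
  qed
  have Bfe: "?B / ?f - e * ?B = ?B / ?f * (1 - e * ?f)"
    using f6 by (simp add: field_simps)
  have "?B / ?f * (1 - e * ?f) > 0"
    using n f6 e by (intro mult_pos_pos) auto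
  then have "stars W \<noteq> {}"
    using b Bfe by auto
  then obtain S1 v1 where S1: "S1 \<in> nsets V (r - 1)" "v1 \<in> W"
    by (auto simp: stars_def star_def)
  then have "S1 \<noteq> {}"
    using r4 by (auto simp: nsets_def)
  then obtain s1 where "s1 \<in> S1"
    by blast
  then have "S1 - {s1} \<in> ?N"
    using S1 by (auto simp: nsets_def)
  then have Nne: "?N \<noteq> {}"
    by auto
  obtain Q where Q: "Q \<in> ?N" and Q_large: "?n * (1 - e * ?f) \<le> real (card (completions (stars W) Q))"
  proof (rule ccontr)
    assume "\<not> thesis"
    then have small: "real (card (completions (stars W) Q)) < ?n * (1 - e * ?f)" if "Q \<in> ?N" for Q
      using that \<open>\<And>Q. Q \<in> ?N \<Longrightarrow> ?n * (1 - e * ?f) \<le> real (card (completions (stars W) Q)) \<Longrightarrow> thesis\<close> by force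
    have "real (r - 1) * real (card (stars W)) = (\<Sum>Q\<in>?N. real (card (completions (stars W) Q)))"
      using arg_cong[OF sum_card_completions[OF stars_subset], of real] by simp
    also have "\<dots> < (\<Sum>Q\<in>?N. ?n * (1 - e * ?f))"
      using Nne finite_nsets_V small by (intro sum_strict_mono) auto
    also have "\<dots> = real (card V choose (r - 2)) * (?n * (1 - e * ?f))"
      using finV by simp
    also have "\<dots> \<le> R / fact (r - 2) * (?n * (1 - e * ?f))"
    proof (rule mult_right_mono)
      show "real (card V choose (r - 2)) \<le> R / fact (r - 2)"
        using of_nat_mono[OF binomial_fact_pow[of "card V" "r - 2"], where 'a = real]
        by (simp add: field_simps R_def)
    qed (use e in auto)
    also have "\<dots> = real (r - 1) * (?B / ?f * (1 - e * ?f))"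
    proof -
      have "real (r - 1) \<noteq> 0"
        using r4 by simp
      then have "real (r - 1) * (?B / ?f) = ?B / fact (r - 2)"
        unfolding f by simp
      then have "real (r - 1) * (?B / ?f) * (1 - e * ?f) = ?n * R / fact (r - 2) * (1 - e * ?f)"
        by (simp only: B)
      then show ?thesis
        by (simp only: mult_ac times_divide_eq_right times_divide_eq_left)
    qed
    also have "\<dots> \<le> real (r - 1) * real (card (stars W))"
      using b Bfe by (intro mult_left_mono) auto
    finally show False by simp
  qed
  \<comment> \<open>A vertex may have several colours; \<open>Y v\<close> keeps those of colour \<open>v\<close> alone, so that the classes are disjoint.
      A set in \<open>Exc\<close> lies in the star of some \<open>v'\<close> and contains a vertex of a colour other than \<open>v'\<close>.\<close>
  define X where "X v = completions (star W v) Q" for v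
  define Z where "Z = completions (stars W) Q"
  define Y where "Y v = {w \<in> X v. \<forall>v'\<in>W. v' \<noteq> v \<longrightarrow> w \<notin> X v'}" for v
  define Exc where "Exc = {S. \<exists>v\<in>W. \<exists>v'\<in>W. v \<noteq> v' \<and> S \<in> star W v' \<and> S \<inter> Q = {} \<and> S \<inter> X v \<noteq> {}}"
  have Z: "Z = (\<Union>v\<in>W. X v)" "Z \<inter> Q = {}" "Z \<subseteq> V"
    by (auto simp: Z_def X_def completions_def stars_def)
  have YZ: "Y v \<subseteq> X v" "Y v \<subseteq> V" for v
    by (auto simp: Y_def X_def completions_def)
  have finY: "finite (Y v)" for v
    using YZ(2) finV finite_subset by blast
  have fin_meet: "finite {S \<in> nsets V (r - 1). S \<inter> A \<noteq> {}}" for A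
    using finite_nsets_V by simp
  have meet: "real (card {S \<in> nsets V (r - 1). S \<inter> (V - A) \<noteq> {}}) \<le> (?n - real (card A)) * R"
    if "A \<subseteq> V" for A
  proof -
    have "card {S \<in> nsets V (r - 1). S \<inter> (V - A) \<noteq> {}} \<le> card (V - A) * card V ^ (r - 1 - 1)"
      using finV r4 by (intro card_nsets_meeting) auto
    also have "card (V - A) = card V - card A"
      using that finV finite_subset by (intro card_Diff_subset) auto
    finally have "real (card {S \<in> nsets V (r - 1). S \<inter> (V - A) \<noteq> {}}) \<le> real ((card V - card A) * card V ^ (r - 1 - 1))"
      by (rule of_nat_mono)
    also have "\<dots> = (?n - real (card A)) * R"
      using card_mono[OF finV that] by (simp add: R_def of_nat_diff numeral_2_eq_2)
    finally show ?thesis .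
  qed
  have Exc: "finite Exc \<and> real (card Exc) \<le> e * ?n * R"
  proof -
    let ?I = "{((v, v'), P) \<in> (W \<times> W) \<times> ?N. v \<noteq> v' \<and> P \<inter> Q = {}}"
    let ?G = "\<lambda>((v, v'), P). (\<lambda>w. insert w P) ` (X v \<inter> completions (star W v') P)"
    have "Exc \<subseteq> (\<Union>i\<in>?I. ?G i)"
    proof
      fix S assume "S \<in> Exc"
      then obtain v v' w where S: "v \<in> W" "v' \<in> W" "v \<noteq> v'" "S \<in> star W v'" "S \<inter> Q = {}" "w \<in> S" "w \<in> X v"
        unfolding Exc_def by blast
      obtain P where P: "S = insert w P" "w \<notin> P"
        using S(6) by (metis mk_disjoint_insert)
      have "P \<in> ?N" "P \<inter> Q = {}" "w \<in> completions (star W v') P"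
        using S P r1 by (auto simp: star_def nsets_def completions_def)
      then have "((v, v'), P) \<in> ?I" "S \<in> ?G ((v, v'), P)"
        using S P by auto
      then show "S \<in> (\<Union>i\<in>?I. ?G i)"
        by blast
    qed
    moreover have finI: "finite ?I"
      by (rule finite_subset[of _ "(W \<times> W) \<times> ?N"]) (auto simp: finW finite_nsets_V)
    moreover have finG: "finite (?G i)" for i
      using finite_completions by (auto simp: split_beta)
    ultimately have "finite Exc" and "card Exc \<le> card (\<Union>i\<in>?I. ?G i)"
      by (auto intro!: card_mono elim!: finite_subset)
    note this(2)
    also have "card (\<Union>i\<in>?I. ?G i) \<le> (\<Sum>i\<in>?I. card (?G i))"
      by (rule card_UN_le[OF finI])
    also have "\<dots> \<le> (\<Sum>i\<in>?I. 1)"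
    proof (rule sum_mono)
      fix i assume "i \<in> ?I"
      then obtain v v' P where i: "i = ((v, v'), P)" "v \<in> W" "v' \<in> W" "P \<in> ?N" "v \<noteq> v'" "P \<inter> Q = {}"
        by auto
      have "card (?G i) \<le> card (X v \<inter> completions (star W v') P)"
        using i(1) finite_completions by (auto intro!: card_image_le)
      also have "\<dots> \<le> 1"
        unfolding X_def using i Q by (intro card_completions_inter_le_1) auto
      finally show "card (?G i) \<le> 1" .
    qed
    also have "\<dots> = card ?I"
      by simp
    also have "\<dots> \<le> card ((W \<times> W) \<times> ?N)"
      using finW finite_nsets_V by (intro card_mono) auto
    also have "\<dots> \<le> (card W)\<^sup>2 * card V ^ (r - 2)"
      using card_nsets_le_power[OF finV, of "r - 2"]
      unfolding card_cartesian_product power2_eq_square by (intro mult_left_mono) auto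
    finally have "real (card Exc) \<le> real ((card W)\<^sup>2 * card V ^ (r - 2))"
      by (rule of_nat_mono)
    also have "\<dots> = real ((card W)\<^sup>2) * R"
      by (simp add: R_def)
    also have "\<dots> \<le> e * ?n * R"
      using cardW R by (intro mult_right_mono) auto
    finally show ?thesis
      using \<open>finite Exc\<close> by blast
  qed
  have "v1 \<in> W"
    by (rule S1(2))
  then have "Max ((\<lambda>v. card (Y v)) ` W) \<in> (\<lambda>v. card (Y v)) ` W"
    using finW by (intro Max_in) auto
  then obtain v where v: "v \<in> W" and "card (Y v) = Max ((\<lambda>v. card (Y v)) ` W)"
    by auto
  then have max: "card (Y v') \<le> card (Y v)" if "v' \<in> W" for v'
    using that finW by simp
  let ?y = "real (card (Y v))"
  have cover: "real (card (stars W)) \<le> e * ?n * R + (?n - real (card Z)) * R + (\<Sum>v\<in>W. real (card (Y v) choose (r - 1)))"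
  proof -
    let ?M = "{S \<in> nsets V (r - 1). S \<inter> (V - Z) \<noteq> {}}"
    have "stars W \<subseteq> Exc \<union> ?M \<union> (\<Union>v\<in>W. nsets (Y v) (r - 1))"
    proof
      fix S assume S: "S \<in> stars W"
      then obtain v' where v': "v' \<in> W" "S \<in> star W v'"
        by (auto simp: stars_def)
      have SV: "S \<in> nsets V (r - 1)"
        using S stars_subset by blast
      show "S \<in> Exc \<union> ?M \<union> (\<Union>v\<in>W. nsets (Y v) (r - 1))"
      proof (cases "S \<in> Exc \<union> ?M")
        case False
        then have SZ: "S \<subseteq> Z"
          using SV by (auto simp: nsets_def)
        then have SQ: "S \<inter> Q = {}"
          using Z(2) by blast
        have only: "v'' = v'" if "w \<in> S" "v'' \<in> W" "w \<in> X v''" for w v''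
          using that False v' SQ unfolding Exc_def by blast
        have "S \<subseteq> Y v'"
        proof
          fix w assume w: "w \<in> S"
          then obtain v'' where v'': "v'' \<in> W" "w \<in> X v''"
            using SZ Z(1) by blast
          then show "w \<in> Y v'"
            using only[OF w] unfolding Y_def by blast
        qed
        then show ?thesis
          using SV v' by (auto simp: nsets_def)
      qed auto
    qed
    then have "card (stars W) \<le> card (Exc \<union> ?M \<union> (\<Union>v\<in>W. nsets (Y v) (r - 1)))"
      using Exc fin_meet finW finite_imp_finite_nsets[OF finY] by (intro card_mono) auto
    also have "\<dots> \<le> card Exc + card ?M + card (\<Union>v\<in>W. nsets (Y v) (r - 1))"
      by (meson add_mono card_Un_le le_refl order_trans)
    also have "card (\<Union>v\<in>W. nsets (Y v) (r - 1)) \<le> (\<Sum>v\<in>W. card (nsets (Y v) (r - 1)))"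
      by (rule card_UN_le[OF finW])
    also have "\<dots> = (\<Sum>v\<in>W. card (Y v) choose (r - 1))"
      using finY by simp
    finally have "real (card (stars W)) \<le> real (card Exc) + real (card ?M) + (\<Sum>v\<in>W. real (card (Y v) choose (r - 1)))"
      by (simp only: of_nat_le_iff flip: of_nat_sum of_nat_add)
    then show ?thesis
      using Exc meet[OF Z(3)] by linarith
  qed
  have nZ: "(?n - real (card Z)) * R \<le> (?f * e * ?n) * R"
    using Q_large R by (intro mult_right_mono) (auto simp: Z_def algebra_simps)
  have sumY: "(\<Sum>v\<in>W. real (card (Y v))) \<le> ?n"
  proof -
    have "(\<Sum>v\<in>W. card (Y v)) = card (\<Union>v\<in>W. Y v)"
      using finW finY by (intro card_UN_disjoint[symmetric]) (auto simp: Y_def)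
    also have "\<dots> \<le> card V"
      using YZ(2) finV by (intro card_mono) auto
    finally show ?thesis
      by (simp only: of_nat_le_iff flip: of_nat_sum)
  qed
  have sum_choose: "?f * (\<Sum>v\<in>W. real (card (Y v) choose (r - 1))) \<le> ?y ^ (r - 2) * ?n"
  proof -
    have "?f * (\<Sum>v\<in>W. real (card (Y v) choose (r - 1))) = (\<Sum>v\<in>W. real ((card (Y v) choose (r - 1)) * fact (r - 1)))"
      by (simp add: sum_distrib_left mult.commute)
    also have "\<dots> \<le> (\<Sum>v\<in>W. real (card (Y v) ^ (r - 1)))"
      by (intro sum_mono of_nat_mono binomial_fact_pow)
    also have "\<dots> \<le> (\<Sum>v'\<in>W. ?y ^ (r - 2) * real (card (Y v')))"
    proof (rule sum_mono)
      fix v' assume "v' \<in> W"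
      then have "real (card (Y v')) ^ (r - 2) * real (card (Y v')) \<le> ?y ^ (r - 2) * real (card (Y v'))"
        using max by (intro mult_right_mono power_mono) auto
      then show "real (card (Y v') ^ (r - 1)) \<le> ?y ^ (r - 2) * real (card (Y v'))"
        unfolding r1 by (simp add: mult.commute)
    qed
    also have "\<dots> = ?y ^ (r - 2) * (\<Sum>v'\<in>W. real (card (Y v')))"
      by (simp add: sum_distrib_left)
    also have "\<dots> \<le> ?y ^ (r - 2) * ?n"
      using sumY by (intro mult_left_mono) auto
    finally show ?thesis .
  qed
  have y_large: "?n - ?y \<le> 2 * ?f\<^sup>2 * e * ?n"
  proof -
    have yn: "?y \<le> ?n"
      using card_mono[OF finV YZ(2)] by simp
    have "?y ^ (r - 2) \<le> ?y * ?n ^ (r - 3)"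
    proof -
      have "r - 2 = Suc (r - 3)"
        using r4 by simp
      then show ?thesis
        using yn by (auto intro!: mult_left_mono power_mono)
    qed
    then have "?y ^ (r - 2) * ?n \<le> ?y * ?n ^ (r - 3) * ?n"
      by (intro mult_right_mono) auto
    also have "\<dots> = ?y * R"
    proof -
      have "r - 2 = Suc (r - 3)"
        using r4 by simp
      then show ?thesis
        by (simp add: R_def)
    qed
    finally have yR: "?y ^ (r - 2) * ?n \<le> ?y * R" .
    have "?n * R / ?f - e * (?n * R) - e * ?n * R - (?f * e * ?n) * R \<le> (\<Sum>v\<in>W. real (card (Y v) choose (r - 1)))"
      using b cover nZ unfolding B by linarith
    then have "?f * (?n * R / ?f - e * (?n * R) - e * ?n * R - (?f * e * ?n) * R) \<le> ?y * R"
      using sum_choose yR f6 by (smt (verit) mult_left_mono)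
    moreover have "?f * (?n * R / ?f - e * (?n * R) - e * ?n * R - (?f * e * ?n) * R)
        = (?n - 2 * ?f * e * ?n - ?f\<^sup>2 * e * ?n) * R"
      using f6 by (simp add: field_simps power2_eq_square)
    ultimately have "?n - 2 * ?f * e * ?n - ?f\<^sup>2 * e * ?n \<le> ?y"
      using R by simp
    moreover have "2 * ?f * (e * ?n) \<le> ?f\<^sup>2 * (e * ?n)"
      using f6 e n unfolding power2_eq_square by (intro mult_right_mono) auto
    ultimately show ?thesis
      by (simp add: algebra_simps)
  qed
  have "stars W \<subseteq> star W v \<union> Exc \<union> {S \<in> nsets V (r - 1). S \<inter> (V - Y v) \<noteq> {}}"
  proof
    fix S assume S: "S \<in> stars W"
    then obtain v' where v': "v' \<in> W" "S \<in> star W v'"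
      by (auto simp: stars_def)
    have SV: "S \<in> nsets V (r - 1)"
      using S stars_subset by blast
    then have "S \<noteq> {}"
      using r4 by (auto simp: nsets_def)
    show "S \<in> star W v \<union> Exc \<union> {S \<in> nsets V (r - 1). S \<inter> (V - Y v) \<noteq> {}}"
    proof (cases "v' = v \<or> S \<inter> (V - Y v) \<noteq> {}")
      case False
      then have "S \<subseteq> Y v"
        using SV by (auto simp: nsets_def)
      then have SX: "S \<subseteq> X v"
        using YZ(1) by (rule order_trans)
      moreover have "X v \<subseteq> Z"
        using v Z(1) by auto
      ultimately have SQ: "S \<inter> Q = {}" "S \<inter> X v \<noteq> {}"
        using Z(2) \<open>S \<noteq> {}\<close> by auto
      have "v \<noteq> v'"
        using False by auto
      with v v' SQ have "S \<in> Exc"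
        unfolding Exc_def mem_Collect_eq by (intro bexI[of _ v] bexI[of _ v'] conjI)
      then show ?thesis
        by (intro UnI1 UnI2)
    next
      case True
      then show ?thesis
        using v'(2) SV by fast
    qed
  qed
  then have "card (stars W) \<le> card (star W v \<union> Exc \<union> {S \<in> nsets V (r - 1). S \<inter> (V - Y v) \<noteq> {}})"
    using Exc fin_meet finite_star by (intro card_mono) auto
  also have "\<dots> \<le> card (star W v) + card Exc + card {S \<in> nsets V (r - 1). S \<inter> (V - Y v) \<noteq> {}}"
    by (meson add_mono card_Un_le le_refl order_trans)
  finally have "real (card (stars W)) \<le> real (card (star W v)) + real (card Exc) + real (card {S \<in> nsets V (r - 1). S \<inter> (V - Y v) \<noteq> {}})"
    by (simp only: of_nat_le_iff flip: of_nat_add)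
  also have "real (card {S \<in> nsets V (r - 1). S \<inter> (V - Y v) \<noteq> {}}) \<le> (2 * ?f\<^sup>2 * e * ?n) * R"
    using meet[OF YZ(2)] y_large R by (meson mult_right_mono less_imp_le order_trans)
  finally have "?n * R / ?f - e * (?n * R) \<le> real (card (star W v)) + e * ?n * R + (2 * ?f\<^sup>2 * e * ?n) * R"
    using b Exc unfolding B by linarith
  moreover have "2 * (e * ?n * R) \<le> 3 * ?f\<^sup>2 * (e * ?n * R)"
  proof (rule mult_right_mono)
    have "?f * ?f \<ge> 2 * 1"
      using f6 by (intro mult_mono) auto
    then show "2 \<le> 3 * ?f\<^sup>2"
      by (simp add: power2_eq_square)
  qed (use e n R in auto)
  ultimately have "?B / ?f - 5 * ?f\<^sup>2 * e * ?B \<le> real (card (star W v))"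
    unfolding B by (simp add: algebra_simps)
  with v show ?thesis
    by blast
qed

lemma card_star_le_degree:
  assumes "v \<in> W"
  shows "card (star W v) \<le> card {A \<in> E. v \<in> A}"
proof (rule card_inj_on_le[of "insert v"])
  show "inj_on (insert v) (star W v)"
    using assms by (intro inj_onI) (auto simp: star_def)
qed (use finE in \<open>auto simp: star_def\<close>)

end

section \<open>A gap in the codegrees\<close>

text \<open>The choice makes \<open>sum_star_completions_le\<close> and \<open>thin_part_le\<close> applicable with
  \<open>\<eta> = \<epsilon> / (w + 2)\<close>, for which the error term \<open>(|W| + 2) \<eta>\<close> is at most \<open>\<epsilon>\<close> when \<open>|W| \<le> w\<close>.\<close>

definition codegree_scale :: "nat \<Rightarrow> real \<Rightarrow> nat \<Rightarrow> real" where
  "codegree_scale r \<epsilon> w = (\<epsilon> / (real w + 2))\<^sup>2 / (2 * real r ^ 3)"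

text \<open>The recursion bounds the sizes of a chain of vertex covers, where the codegree threshold of each step is
  adapted to the size of the cover already reached.\<close>

primrec cover_bound :: "nat \<Rightarrow> real \<Rightarrow> nat \<Rightarrow> nat" where
  "cover_bound r \<epsilon> 0 = 0"
| "cover_bound r \<epsilon> (Suc i) =
     cover_bound r \<epsilon> i + r * nat \<lceil>2 / (codegree_scale r \<epsilon> (cover_bound r \<epsilon> i))\<^sup>2\<rceil>"

lemma cover_bound_mono: "i \<le> j \<Longrightarrow> cover_bound r \<epsilon> i \<le> cover_bound r \<epsilon> j"
  by (rule lift_Suc_mono_le[of "cover_bound r \<epsilon>"]) auto

context c4_free_graph
begin

definition avoiding :: "'a set \<Rightarrow> 'a set set" where
  "avoiding W = {A \<in> E. A \<inter> W = {}}"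

lemma finite_avoiding: "finite (avoiding W)"
  unfolding avoiding_def using finE by simp

lemma cover_step:
  fixes c :: real
  assumes c: "c > 0" and W: "W \<subseteq> V"
  obtains W' where "W \<subseteq> W'" "W' \<subseteq> V" "card W' \<le> card W + r * nat \<lceil>2 / c\<^sup>2\<rceil>"
    "\<And>S. card S = r - 1 \<Longrightarrow> real (card (link (avoiding W') S)) \<le> c * card V"
proof -
  have "real (nat \<lceil>2 / c\<^sup>2\<rceil>) \<ge> 2 / c\<^sup>2"
    by linarith
  then obtain U where U: "U \<subseteq> V" "card U \<le> r * nat \<lceil>2 / c\<^sup>2\<rceil>"
    "\<And>S. card S = r - 1 \<Longrightarrow> real (card (link E S)) \<ge> c * card V \<Longrightarrow> link E S \<noteq> {} \<Longrightarrow> S \<inter> U \<noteq> {}"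
    using rich_sets_cover[OF c, of "nat \<lceil>2 / c\<^sup>2\<rceil>"] by blast
  have "real (card (link (avoiding (W \<union> U)) S)) \<le> c * card V" if S: "card S = r - 1" for S
  proof (cases "link (avoiding (W \<union> U)) S = {}")
    case True
    then show ?thesis
      using c by simp
  next
    case False
    have sub: "link (avoiding (W \<union> U)) S \<subseteq> link E S"
      by (intro link_mono) (auto simp: avoiding_def)
    have "S \<inter> U = {}"
      using False by (auto simp: link_def avoiding_def)
    then have "real (card (link E S)) < c * card V"
      using U(3)[OF S] False sub by fastforce
    then show ?thesis
      using card_mono[OF finite_link sub] by linarith
  qed
  moreover have "card (W \<union> U) \<le> card W + r * nat \<lceil>2 / c\<^sup>2\<rceil>"
    using card_Un_le[of W U] U(2) by linarith
  ultimately show ?thesis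
    using that[of "W \<union> U"] U(1) W by blast
qed

text \<open>Starting from the empty set, \<open>cover_step\<close> is iterated.  A step from \<open>W\<close> to \<open>W'\<close> that does not satisfy the
  conclusion removes more than \<open>\<epsilon> n^(r-1)\<close> further edges, which is possible fewer than \<open>1 / \<epsilon>\<close> times.  What
  matters is that the codegrees outside \<open>W'\<close> are small compared with the size of \<open>W\<close>, not of \<open>W'\<close>.\<close>

lemma codegree_gap:
  fixes \<epsilon> :: real and T :: nat
  assumes \<epsilon>: "\<epsilon> > 0" and T: "real T * \<epsilon> > 1" and V: "V \<noteq> {}"
    and E_le: "real (card E) \<le> real (card V) ^ (r - 1)"
  obtains i W W' where "i \<le> T" "W \<subseteq> W'" "W' \<subseteq> V" "card W \<le> cover_bound r \<epsilon> i"
    "real (card (avoiding W)) \<le> real (card (avoiding W')) + \<epsilon> * real (card V) ^ (r - 1)"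
    "\<And>S. card S = r - 1 \<Longrightarrow>
       real (card (link (avoiding W') S)) \<le> codegree_scale r \<epsilon> (cover_bound r \<epsilon> i) * card V"
proof (rule ccontr)
  assume no: "\<not> thesis"
  note witness = that
  let ?B = "real (card V) ^ (r - 1)"
  have n: "real (card V) > 0"
    using finV V by (simp add: card_gt_0_iff)
  have "\<exists>W. W \<subseteq> V \<and> card W \<le> cover_bound r \<epsilon> i \<and> real (card (avoiding W)) + real i * \<epsilon> * ?B \<le> real (card E)"
    if "i \<le> T" for i
    using that
  proof (induction i)
    case 0
    have "avoiding {} = E"
      by (auto simp: avoiding_def)
    then show ?case
      by (intro exI[of _ "{}"]) auto
  next
    case (Suc i)
    then obtain W where W: "W \<subseteq> V" "card W \<le> cover_bound r \<epsilon> i"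
      "real (card (avoiding W)) + real i * \<epsilon> * ?B \<le> real (card E)"
      by auto
    let ?c = "codegree_scale r \<epsilon> (cover_bound r \<epsilon> i)"
    have "?c > 0"
      using \<epsilon> r4 by (simp add: codegree_scale_def)
    then obtain W' where W': "W \<subseteq> W'" "W' \<subseteq> V" "card W' \<le> card W + r * nat \<lceil>2 / ?c\<^sup>2\<rceil>"
      "\<And>S. card S = r - 1 \<Longrightarrow> real (card (link (avoiding W') S)) \<le> ?c * card V"
      using cover_step[OF _ W(1)] by blast
    have "\<not> real (card (avoiding W)) \<le> real (card (avoiding W')) + \<epsilon> * ?B"
      using no witness[of i W W'] Suc.prems W W' by auto
    then have "real (card (avoiding W')) + real (Suc i) * \<epsilon> * ?B \<le> real (card E)"
      using W(3) by (simp add: algebra_simps)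
    moreover have "card W' \<le> cover_bound r \<epsilon> (Suc i)"
      using W(2) W'(3) by simp
    ultimately show ?case
      using W'(2) by blast
  qed
  then obtain W where "real (card (avoiding W)) + real T * \<epsilon> * ?B \<le> real (card E)"
    by blast
  then have "real T * \<epsilon> * ?B \<le> 1 * ?B"
    using E_le by linarith
  then show False
    using T n by simp
qed

section \<open>The stability theorem\<close>

text \<open>Put \<open>L = n^(r-1) / (r-1)!\<close> and let \<open>b\<close> be the number of sets in the stars.  The edges meeting \<open>W\<close>, those
  meeting \<open>W'\<close> but not \<open>W\<close>, those deleted to obtain centres, and the rest add up to at most
  \<open>b + 5/8 (L - b) + 4 \<epsilon> n^(r-1)\<close>.  Comparison with the lower bound on the number of edges gives
  \<open>3/8 (L - b) \<le> 6 \<epsilon> n^(r-1)\<close>.\<close>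

lemma stars_cover_almost_all:
  fixes \<epsilon> :: real and T :: nat
  assumes \<epsilon>: "0 < \<epsilon>" "\<epsilon> \<le> 1" and T: "real T * \<epsilon> > 1" and V: "V \<noteq> {}"
    and E_le: "real (card E) \<le> real (card V) ^ (r - 1)"
    and E_ge: "real (card V) ^ (r - 1) / fact (r - 1) - 2 * \<epsilon> * real (card V) ^ (r - 1) \<le> real (card E)"
    and n: "real (r * (cover_bound r \<epsilon> T)\<^sup>2) \<le> \<epsilon> * real (card V)"
  obtains W where "W \<subseteq> V" "real ((card W)\<^sup>2) \<le> \<epsilon> * real (card V)"
    "real (card V) ^ (r - 1) / fact (r - 1) - 16 * \<epsilon> * real (card V) ^ (r - 1) \<le> real (card (stars W))"
proof -
  let ?n = "real (card V)"
  let ?B = "?n ^ (r - 1)"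
  obtain i W W' where i: "i \<le> T" and W: "W \<subseteq> W'" "W' \<subseteq> V" "card W \<le> cover_bound r \<epsilon> i"
    and gap: "real (card (avoiding W)) \<le> real (card (avoiding W')) + \<epsilon> * ?B"
    and cod: "\<And>S. card S = r - 1 \<Longrightarrow>
       real (card (link (avoiding W') S)) \<le> codegree_scale r \<epsilon> (cover_bound r \<epsilon> i) * card V"
    using codegree_gap[OF \<epsilon>(1) T V E_le] by blast
  define w where "w = cover_bound r \<epsilon> i"
  define c where "c = codegree_scale r \<epsilon> w"
  define \<eta> where "\<eta> = \<epsilon> / (real w + 2)"
  have c0: "c \<ge> 0" and c_\<eta>: "2 * real r ^ 3 * c \<le> \<eta>\<^sup>2" and \<eta>0: "\<eta> \<ge> 0"
    using r4 \<epsilon> by (auto simp: c_def codegree_scale_def \<eta>_def)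
  have \<eta>_le: "\<eta> \<le> \<epsilon>" and W\<eta>: "(real (card W) + 2) * \<eta> \<le> \<epsilon>"
  proof -
    have "\<epsilon> * 1 \<le> \<epsilon> * (real w + 2)"
      using \<epsilon> by (intro mult_left_mono) auto
    then show "\<eta> \<le> \<epsilon>"
      by (simp add: \<eta>_def field_simps)
    have "(real (card W) + 2) * \<eta> \<le> (real w + 2) * \<eta>"
      using W(3) \<eta>0 by (intro mult_right_mono) (auto simp: w_def)
    also have "\<dots> = \<epsilon>"
      by (simp add: \<eta>_def)
    finally show "(real (card W) + 2) * \<eta> \<le> \<epsilon>" .
  qed
  have rc: "real r ^ 2 * c \<le> \<epsilon>"
  proof -
    have "real r ^ 2 * 1 \<le> real r ^ 2 * (2 * real r)"
      using r4 by (intro mult_left_mono) auto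
    then have "real r ^ 2 * c \<le> 2 * real r ^ 3 * c"
      using c0 by (intro mult_right_mono) (auto simp: power2_eq_square power3_eq_cube)
    also have "\<dots> \<le> \<eta> * \<eta>"
      using c_\<eta> by (simp add: power2_eq_square)
    also have "\<dots> \<le> \<epsilon> * 1"
      using \<eta>_le \<eta>0 \<epsilon> by (intro mult_mono) auto
    finally show ?thesis by simp
  qed
  have WV: "W \<subseteq> V"
    using W by blast
  have cardW: "real (r * (card W)\<^sup>2) \<le> \<epsilon> * ?n"
  proof -
    have "card W \<le> cover_bound r \<epsilon> T"
      using W(3) cover_bound_mono[OF i] order_trans by blast
    then have "r * (card W)\<^sup>2 \<le> r * (cover_bound r \<epsilon> T)\<^sup>2"
      by (intro mult_left_mono power_mono) auto
    then show ?thesis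
      using n by linarith
  qed
  have av_sub: "avoiding W' \<subseteq> E"
    by (auto simp: avoiding_def)
  interpret A: c4_free_graph r V "avoiding W'"
    by (rule subgraph[OF av_sub])
  have thin: "real (card {A \<in> avoiding W'. T \<subseteq> A}) \<le> c * ?n ^ (r - 3)" if "card T = 3" for T
    using A.triple_degree_le[OF c0, of T] cod that by (simp add: c_def w_def)
  obtain E' ctr where E': "E' \<subseteq> avoiding W'"
    "real (card (avoiding W')) \<le> real (card E') + ?n ^ 2 * (real r ^ 2 * (c * ?n ^ (r - 3)))"
    "\<And>x y S. x \<noteq> y \<Longrightarrow> S \<in> link E' {x} \<Longrightarrow> S \<in> link E' {y} \<Longrightarrow> ctr x y \<in> S"
    using A.centered_subgraph[of "c * ?n ^ (r - 3)"] thin c0 by (metis (no_types, lifting) mult_nonneg_nonneg of_nat_0_le_iff zero_le_power)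
  have E'E: "E' \<subseteq> E"
    using E'(1) av_sub by blast
  have thin': "real (card {A \<in> E'. T \<subseteq> A}) \<le> c * ?n ^ (r - 3)" if "card T = 3" for T
  proof -
    have "card {A \<in> E'. T \<subseteq> A} \<le> card {A \<in> avoiding W'. T \<subseteq> A}"
      using E'(1) finite_avoiding by (intro card_mono) auto
    then show ?thesis
      using thin[OF that] by linarith
  qed
  have avoid: "A \<inter> W = {}" if "A \<in> E'" for A
    using that E'(1) W(1) by (auto simp: avoiding_def)
  have "real (card E') \<le> real (card E)"
    using card_mono[OF finE E'E] by simp
  then have E'B: "real (card E') \<le> ?B"
    using E_le by linarith
  let ?b = "real (card (stars W))" and ?L = "?B / fact (r - 1)"
  have "real (card E') \<le> 5 / 8 * (?L - ?b) + (real (card W) + 2) * \<eta> * ?B"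
    using WV E'E avoid thin' E'(3) c0 E'B \<eta>0 c_\<eta> V by (rule thin_part_le)
  moreover have "(real (card W) + 2) * \<eta> * ?B \<le> \<epsilon> * ?B"
    using W\<eta> by (intro mult_right_mono) auto
  moreover have "?n ^ 2 * (real r ^ 2 * (c * ?n ^ (r - 3))) \<le> \<epsilon> * ?B"
  proof -
    have "2 + (r - 3) = r - 1"
      using r4 by simp
    then have "?n ^ 2 * ?n ^ (r - 3) = ?B"
      by (metis power_add)
    then have "?n ^ 2 * (real r ^ 2 * (c * ?n ^ (r - 3))) = (real r ^ 2 * c) * ?B"
      by (metis mult.assoc mult.left_commute)
    also have "\<dots> \<le> \<epsilon> * ?B"
      using rc by (intro mult_right_mono) auto
    finally show ?thesis .
  qed
  moreover have "real (card E) \<le> ?b + \<epsilon> * ?B + real (card (avoiding W))"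
  proof -
    have "E = {A \<in> E. A \<inter> W \<noteq> {}} \<union> avoiding W"
      by (auto simp: avoiding_def)
    then have "card E \<le> card {A \<in> E. A \<inter> W \<noteq> {}} + card (avoiding W)"
      by (metis card_Un_le)
    also have "\<dots> \<le> card (stars W) + r * (card W)\<^sup>2 * card V ^ (r - 2) + card (avoiding W)"
      using card_edges_meeting_le[OF WV] by simp
    finally have "real (card E) \<le> ?b + real (r * (card W)\<^sup>2) * ?n ^ (r - 2) + real (card (avoiding W))"
      by (simp only: of_nat_le_iff flip: of_nat_add of_nat_mult of_nat_power)
    also have "real (r * (card W)\<^sup>2) * ?n ^ (r - 2) \<le> \<epsilon> * ?n * ?n ^ (r - 2)"
      using cardW by (intro mult_right_mono) auto
    also have "\<epsilon> * ?n * ?n ^ (r - 2) = \<epsilon> * ?B"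
    proof -
      have "Suc (r - 2) = r - 1"
        using r4 by simp
      then show ?thesis
        by (metis power_Suc mult.assoc)
    qed
    finally show ?thesis by simp
  qed
  ultimately have "?L - 16 * \<epsilon> * ?B \<le> ?b"
    using E_ge gap E'(2) by (simp add: algebra_simps)
  moreover have "real ((card W)\<^sup>2) \<le> \<epsilon> * ?n"
  proof -
    have "(card W)\<^sup>2 \<le> r * (card W)\<^sup>2"
      using r4 by simp
    then show ?thesis
      using cardW by linarith
  qed
  ultimately show ?thesis
    using that WV by blast
qed

text \<open>Deleting edges preserves the hypotheses as long as enough edges remain, and the conclusion passes to
  supergraphs.  So it may be assumed that there are at most \<open>n^(r-1)\<close> edges, as \<open>stars_cover_almost_all\<close>
  requires.\<close>

lemma large_degree_vertex:
  fixes \<epsilon> :: real and T :: nat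
  assumes \<epsilon>: "0 < \<epsilon>" "16 * \<epsilon> * fact (r - 1) < 1" and T: "real T * \<epsilon> > 1" and V: "V \<noteq> {}"
    and E_ge: "real (card V) ^ (r - 1) / fact (r - 1) - 2 * \<epsilon> * real (card V) ^ (r - 1) \<le> real (card E)"
    and n: "real (r * (cover_bound r \<epsilon> T)\<^sup>2) \<le> \<epsilon> * real (card V)"
  shows "\<exists>v\<in>V. real (card V) ^ (r - 1) / fact (r - 1) - 80 * (fact (r - 1))\<^sup>2 * \<epsilon> * real (card V) ^ (r - 1)
    \<le> real (card {A \<in> E. v \<in> A})"
proof -
  let ?n = "real (card V)"
  let ?B = "?n ^ (r - 1)"
  have B: "?B \<ge> 0" by simp
  obtain E0 where E0: "E0 \<subseteq> E" "card E0 = min (card E) (card V ^ (r - 1))"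
    by (meson min.cobounded1 obtain_subset_with_card_n)
  interpret S: c4_free_graph r V E0
    by (rule subgraph[OF E0(1)])
  have "?B / fact (r - 1) \<le> ?B / 1"
    by (intro divide_left_mono) auto
  moreover have "2 * \<epsilon> * ?B \<ge> 0"
    using \<epsilon> by simp
  ultimately have E0_ge: "?B / fact (r - 1) - 2 * \<epsilon> * ?B \<le> real (card E0)"
    using E_ge E0(2) by (auto simp: min_def)
  have E0_le: "real (card E0) \<le> ?B"
    using E0(2) by (metis min.cobounded2 of_nat_le_iff of_nat_power)
  have \<epsilon>1: "\<epsilon> \<le> 1"
  proof -
    have "16 * \<epsilon> * 1 \<le> 16 * \<epsilon> * fact (r - 1)"
      using \<epsilon> by (intro mult_left_mono) auto
    then show ?thesis
      using \<epsilon> by linarith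
  qed
  obtain W where W: "W \<subseteq> V" "real ((card W)\<^sup>2) \<le> \<epsilon> * ?n"
    "?B / fact (r - 1) - 16 * \<epsilon> * ?B \<le> real (card (S.stars W))"
    using S.stars_cover_almost_all[OF \<epsilon>(1) \<epsilon>1 T V E0_le E0_ge n] by blast
  have "\<epsilon> * ?n \<le> (16 * \<epsilon>) * ?n"
    using \<epsilon> by (intro mult_right_mono) auto
  then have W2: "real ((card W)\<^sup>2) \<le> (16 * \<epsilon>) * ?n"
    using W(2) by linarith
  obtain v where v: "v \<in> W" "?B / fact (r - 1) - 5 * (fact (r - 1))\<^sup>2 * (16 * \<epsilon>) * ?B \<le> real (card (S.star W v))"
    using S.dominant_star[OF W(1) V W(3) W2] \<epsilon> by auto
  have "card (S.star W v) \<le> card {A \<in> E0. v \<in> A}"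
    by (rule S.card_star_le_degree[OF v(1)])
  also have "\<dots> \<le> card {A \<in> E. v \<in> A}"
    using E0(1) finE by (intro card_mono) auto
  finally have "?B / fact (r - 1) - 80 * (fact (r - 1))\<^sup>2 * \<epsilon> * ?B \<le> real (card {A \<in> E. v \<in> A})"
    using v(2) by (simp add: algebra_simps)
  then show ?thesis
    using v(1) W(1) by blast
qed

end

theorem theorem1p3:
  fixes r :: nat
  assumes "r \<ge> 4"
  shows "\<forall>\<delta>::real. \<delta> > 0 \<longrightarrow>
    (\<exists>(\<epsilon>::real) (n0::nat). \<epsilon> > 0 \<and>
      (\<forall>n \<ge> n0. \<forall>(V :: 'a set) E.
         r_graph r V E \<and> card V = n \<and> gen_4_cycle_free r E \<and>
         real (card E) \<ge> (1 - \<epsilon>) * real ((n - 1) choose (r - 1)) \<longrightarrow>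
         (\<exists>v \<in> V. real (card {e \<in> E. v \<in> e}) \<ge> (1 - \<delta>) * real ((n - 1) choose (r - 1)))))"
proof (intro allI impI)
  fix \<delta> :: real
  assume \<delta>: "\<delta> > 0"
  define \<delta>' where "\<delta>' = min \<delta> 1"
  define f where "f = (fact (r - 1) :: real)"
  \<comment> \<open>With this choice the loss \<open>80 f\<^sup>2 \<epsilon> n^(r-1)\<close> in \<open>large_degree_vertex\<close> is exactly \<open>\<delta>' n^(r-1) / f\<close>.\<close>
  define \<epsilon> where "\<epsilon> = \<delta>' / (80 * f ^ 3)"
  define T where "T = nat \<lceil>1 / \<epsilon>\<rceil> + 1"
  define n0 where "n0 = nat \<lceil>(real (r\<^sup>2) + real (r * (cover_bound r \<epsilon> T)\<^sup>2)) / \<epsilon>\<rceil> + 1"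
  have \<delta>': "0 < \<delta>'" "\<delta>' \<le> 1" "\<delta>' \<le> \<delta>"
    using \<delta> by (auto simp: \<delta>'_def)
  have f1: "f \<ge> 1"
    by (simp add: f_def)
  have \<epsilon>0: "\<epsilon> > 0"
    using \<delta>' f1 by (simp add: \<epsilon>_def)
  have \<epsilon>f: "80 * f\<^sup>2 * \<epsilon> = \<delta>' / f"
    using f1 by (simp add: \<epsilon>_def power2_eq_square power3_eq_cube)
  have "16 * \<epsilon> * f \<le> 16 * \<epsilon> * f\<^sup>2"
    using \<epsilon>0 f1 by (intro mult_left_mono) (auto simp: power2_eq_square)
  moreover have "80 * f\<^sup>2 * \<epsilon> \<le> 1"
    unfolding \<epsilon>f using \<delta>' f1 by (simp add: divide_le_eq)
  moreover have "80 * f\<^sup>2 * \<epsilon> = 5 * (16 * \<epsilon> * f\<^sup>2)"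
    by simp
  ultimately have \<epsilon>_small: "16 * \<epsilon> * f < 1"
    by linarith
  have T: "real T * \<epsilon> > 1"
  proof -
    have "real T > 1 / \<epsilon>"
      unfolding T_def by linarith
    then show ?thesis
      using \<epsilon>0 by (simp add: field_simps)
  qed
  have main: "\<exists>v \<in> V. real (card {e \<in> E. v \<in> e}) \<ge> (1 - \<delta>) * real ((n - 1) choose (r - 1))"
    if n: "n \<ge> n0" and G: "r_graph r V E" "card V = n" "gen_4_cycle_free r E"
      and E: "real (card E) \<ge> (1 - \<epsilon>) * real ((n - 1) choose (r - 1))" for n and V :: "'a set" and E
  proof -
    interpret c4_free_graph r V E
      using assms G by unfold_locales (auto simp: r_graph_def)
    let ?C = "real ((n - 1) choose (r - 1))" and ?B = "real n ^ (r - 1)"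
    have "real n \<ge> (real (r\<^sup>2) + real (r * (cover_bound r \<epsilon> T)\<^sup>2)) / \<epsilon>"
      using n unfolding n0_def by linarith
    then have large: "real (r\<^sup>2) + real (r * (cover_bound r \<epsilon> T)\<^sup>2) \<le> \<epsilon> * real n"
      using \<epsilon>0 by (simp add: field_simps)
    have n_pos: "n > 0"
      using n by (simp add: n0_def)
    then have V_ne: "V \<noteq> {}"
      using G(2) by auto
    have cover: "real (r * (cover_bound r \<epsilon> T)\<^sup>2) \<le> \<epsilon> * real (card V)"
    proof -
      have "real (r\<^sup>2) \<ge> 0" by simp
      then show ?thesis
        unfolding G(2) using large by linarith
    qed
    have C_le: "?C \<le> ?B / f"
    proof -
      have "((n - 1) choose (r - 1)) * fact (r - 1) \<le> n ^ (r - 1)"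
        using binomial_fact_pow[of "n - 1" "r - 1"] power_mono[of "n - 1" n "r - 1"] by linarith
      then have "?C * f \<le> ?B"
        unfolding f_def by (metis of_nat_le_iff of_nat_mult of_nat_fact of_nat_power)
      then show ?thesis
        using f1 by (simp add: field_simps)
    qed
    have C_ge: "(1 - \<epsilon>) * (?B / f) \<le> ?C"
    proof -
      have r1: "Suc (r - 1) = r"
        using assms by simp
      have "real n * ?B - real r ^ 2 * ?B \<le> ?C * f * real n"
        using binomial_fact_lower_bound[of n "r - 1"] unfolding r1 f_def
        by (metis r1 power_Suc)
      moreover have "real r ^ 2 * ?B \<le> \<epsilon> * real n * ?B"
        using large by (intro mult_right_mono) (auto intro: order_trans[rotated])
      ultimately have "real n * ((1 - \<epsilon>) * ?B) \<le> real n * (?C * f)"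
        by (simp add: algebra_simps)
      then have "(1 - \<epsilon>) * ?B \<le> ?C * f"
        using n_pos by simp
      then show ?thesis
        using f1 by (simp add: field_simps)
    qed
    have "?B / f - 2 * \<epsilon> * ?B \<le> real (card E)"
    proof -
      have "\<epsilon> * 1 \<le> \<epsilon> * f"
        using \<epsilon>0 f1 by (intro mult_left_mono) auto
      then have \<epsilon>1: "\<epsilon> \<le> 1"
        using \<epsilon>_small \<epsilon>0 by linarith
      have square: "(1 - a) * ((1 - a) * x) = x - 2 * a * x + a * a * x" for a x :: real
        by (simp add: algebra_simps)
      have "?B / f \<le> ?B / 1"
        using f1 by (intro divide_left_mono) auto
      then have "2 * \<epsilon> * (?B / f) \<le> 2 * \<epsilon> * ?B"
        using \<epsilon>0 by (intro mult_left_mono) auto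
      moreover have "0 \<le> \<epsilon> * \<epsilon> * (?B / f)"
        using f1 by simp
      moreover have "(1 - \<epsilon>) * ((1 - \<epsilon>) * (?B / f)) = ?B / f - 2 * \<epsilon> * (?B / f) + \<epsilon> * \<epsilon> * (?B / f)"
        by (rule square)
      moreover have "(1 - \<epsilon>) * ((1 - \<epsilon>) * (?B / f)) \<le> (1 - \<epsilon>) * ?C"
        using \<epsilon>1 C_ge by (intro mult_left_mono) auto
      ultimately show ?thesis
        using E by linarith
    qed
    then obtain v where v: "v \<in> V" "?B / f - 80 * f\<^sup>2 * \<epsilon> * ?B \<le> real (card {A \<in> E. v \<in> A})"
      using large_degree_vertex[OF \<epsilon>0 _ T V_ne _ cover] \<epsilon>_small unfolding f_def G(2) by blast
    have "(1 - \<delta>) * ?C \<le> (1 - \<delta>') * ?C"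
      using \<delta>' by (intro mult_right_mono) auto
    also have "\<dots> \<le> (1 - \<delta>') * (?B / f)"
      using \<delta>' C_le by (intro mult_left_mono) auto
    also have "\<dots> = ?B / f - 80 * f\<^sup>2 * \<epsilon> * ?B"
      unfolding \<epsilon>f by (simp add: left_diff_distrib diff_divide_distrib)
    finally show ?thesis
      using v by force
  qed
  show "\<exists>(\<epsilon>::real) (n0::nat). \<epsilon> > 0 \<and>
      (\<forall>n \<ge> n0. \<forall>(V :: 'a set) E.
         r_graph r V E \<and> card V = n \<and> gen_4_cycle_free r E \<and>
         real (card E) \<ge> (1 - \<epsilon>) * real ((n - 1) choose (r - 1)) \<longrightarrow>
         (\<exists>v \<in> V. real (card {e \<in> E. v \<in> e}) \<ge> (1 - \<delta>) * real ((n - 1) choose (r - 1))))"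
    using \<epsilon>0 main by blast
qed

end
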